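(* Let $T$ be an $\omega_1$-tree, let $S\subset T$ be an uncountable subset which is $\omega_1$-compact in the subspace topology, and let $M$ be a manifold which contains a subspace homeomorphic to $S$. Then $M$ is not homotopy equivalent to a CW-complex. In particular, a manifold containing a subspace homeomorphic to a Suslin tree is not homotopy equivalent to a CW-complex.
   Context: A manifold is a connected Hausdorff space each of whose points has a neighborhood homeomorphic to $\mathbb{R}^n$ for some finite $n\ge 1$ (no second countability or metrizability is assumed). A space is $\omega_1$-compact if each of its closed discrete subsets is at most countable. A tree is a partially ordered set $T$ in which the set of predecessors of each point is well ordered; the height of a point is the order type of its set of predecessors, the $\alpha$-th level is the set of points of height $\alpha$, and the height of $T$ is the least $\alpha$ such that the $\alpha$-th level is empty. Every tree is endowed with its order (interval) topology, in which minimal points are isolated and a point $x$ which is not minimal has as a neighborhood basis the sets $\{w\in T: z<w\le x\}$ for $z<x$. All trees are assumed Hausdorff, i.e. two points at the same limit level with the same predecessors are equal. An $\omega_1$-tree is a tree of height $\omega_1$ all of whose levels are countable. A Suslin tree is a tree of height $\omega_1$ all of whose chains and antichains are at most countable. *)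

theory Defs
  imports "HOL-Analysis.Analysis"
begin

section \<open>Trees\<close>

text \<open>
  A partial order on a carrier set is given by its reflexive relation, so that
  \<^term>\<open>underS r x\<close> is the set of strict predecessors of \<^term>\<open>x\<close>.
\<close>

definition is_tree :: "'a set \<Rightarrow> 'a rel \<Rightarrow> bool" where
  "is_tree T r \<longleftrightarrow> partial_order_on T r \<and>
     (\<forall>x\<in>T. well_order_on (underS r x) (Restr r (underS r x)))"

definition tree_interval :: "'a rel \<Rightarrow> 'a \<Rightarrow> 'a \<Rightarrow> 'a set" where
  "tree_interval r z x = {w. z \<in> underS r w \<and> (w, x) \<in> r}"

definition tree_topology :: "'a set \<Rightarrow> 'a rel \<Rightarrow> 'a topology" where
  "tree_topology T r = topology_generated_by
     ({{x} |x. x \<in> T \<and> underS r x = {}} \<union>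
      {tree_interval r z x |z x. x \<in> T \<and> z \<in> underS r x})"

definition hausdorff_tree :: "'a set \<Rightarrow> 'a rel \<Rightarrow> bool" where
  "hausdorff_tree T r \<longleftrightarrow> is_tree T r \<and> Hausdorff_space (tree_topology T r)"

text \<open>
  Ordinals are represented by well-order relations up to isomorphism (\<^const>\<open>ordIso\<close>). A relation that is
  not a well-order is not \<^const>\<open>ordIso\<close>-related to anything, so the corresponding level is empty.
\<close>

definition tree_level :: "'a set \<Rightarrow> 'a rel \<Rightarrow> 'b rel \<Rightarrow> 'a set" where
  "tree_level T r \<alpha> = {x\<in>T. (Restr r (underS r x), \<alpha>) \<in> ordIso}"

text \<open>
  Every ordinal below \<open>\<gamma>\<close> is the order type of an initial segment of \<open>\<gamma>\<close>; hence quantifying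
  over relations \<open>\<alpha>\<close> on the type of \<open>\<gamma>\<close> covers all smaller ordinals.
\<close>

definition has_tree_height :: "'a set \<Rightarrow> 'a rel \<Rightarrow> 'b rel \<Rightarrow> bool" where
  "has_tree_height T r \<gamma> \<longleftrightarrow> Well_order \<gamma> \<and> tree_level T r \<gamma> = {} \<and>
     (\<forall>\<alpha> :: 'b rel. (\<alpha>, \<gamma>) \<in> ordLess \<longrightarrow> tree_level T r \<alpha> \<noteq> {})"

definition omega1 :: "nat set rel" where
  "omega1 = cardSuc natLeq"

definition omega1_tree :: "'a set \<Rightarrow> 'a rel \<Rightarrow> bool" where
  "omega1_tree T r \<longleftrightarrow> hausdorff_tree T r \<and> has_tree_height T r omega1 \<and>
     (\<forall>\<alpha> :: nat set rel. countable (tree_level T r \<alpha>))"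

definition tree_chain :: "'a set \<Rightarrow> 'a rel \<Rightarrow> 'a set \<Rightarrow> bool" where
  "tree_chain T r C \<longleftrightarrow> C \<subseteq> T \<and> (\<forall>x\<in>C. \<forall>y\<in>C. (x, y) \<in> r \<or> (y, x) \<in> r)"

definition tree_antichain :: "'a set \<Rightarrow> 'a rel \<Rightarrow> 'a set \<Rightarrow> bool" where
  "tree_antichain T r A \<longleftrightarrow> A \<subseteq> T \<and>
     (\<forall>x\<in>A. \<forall>y\<in>A. x \<noteq> y \<longrightarrow> (x, y) \<notin> r \<and> (y, x) \<notin> r)"

definition suslin_tree :: "'a set \<Rightarrow> 'a rel \<Rightarrow> bool" where
  "suslin_tree T r \<longleftrightarrow> hausdorff_tree T r \<and> has_tree_height T r omega1 \<and>
     (\<forall>C. tree_chain T r C \<longrightarrow> countable C) \<and>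
     (\<forall>A. tree_antichain T r A \<longrightarrow> countable A)"


section \<open>Spaces\<close>

definition omega1_compact :: "'a topology \<Rightarrow> bool" where
  "omega1_compact X \<longleftrightarrow>
     (\<forall>D. closedin X D \<and> subtopology X D = discrete_topology D \<longrightarrow> countable D)"

definition contains_copy :: "'a topology \<Rightarrow> 'b topology \<Rightarrow> bool" where
  "contains_copy X Y \<longleftrightarrow> (\<exists>N \<subseteq> topspace X. subtopology X N homeomorphic_space Y)"

definition manifold_space :: "'a topology \<Rightarrow> bool" where
  "manifold_space M \<longleftrightarrow> connected_space M \<and> Hausdorff_space M \<and>
     (\<forall>x \<in> topspace M. \<exists>n\<ge>1. \<exists>U \<subseteq> topspace M.
        x \<in> M interior_of U \<and> subtopology M U homeomorphic_space Euclidean_space n)"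


section \<open>CW-complexes\<close>

definition unit_disc :: "nat \<Rightarrow> (nat \<Rightarrow> real) set" where
  "unit_disc n = {x \<in> topspace (Euclidean_space n). (\<Sum>i<n. (x i)\<^sup>2) \<le> 1}"

definition open_unit_disc :: "nat \<Rightarrow> (nat \<Rightarrow> real) set" where
  "open_unit_disc n = {x \<in> topspace (Euclidean_space n). (\<Sum>i<n. (x i)\<^sup>2) < 1}"

text \<open>
  Whitehead's definition: \<open>E\<close> is the set of open cells, \<open>d e\<close> is the dimension of the cell \<open>e\<close>
  and \<open>\<Phi> e\<close> its characteristic map. The last two clauses are closure-finiteness and the weak
  topology. There is no bound on the number or on the dimensions of the cells.
\<close>

definition cw_structure ::
  "'a topology \<Rightarrow> 'a set set \<Rightarrow> ('a set \<Rightarrow> nat) \<Rightarrow> ('a set \<Rightarrow> (nat \<Rightarrow> real) \<Rightarrow> 'a) \<Rightarrow> bool" where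
  "cw_structure X E d \<Phi> \<longleftrightarrow>
     Hausdorff_space X \<and> \<Union>E = topspace X \<and> disjoint E \<and>
     (\<forall>e\<in>E. continuous_map (subtopology (Euclidean_space (d e)) (unit_disc (d e))) X (\<Phi> e) \<and>
        homeomorphic_map (subtopology (Euclidean_space (d e)) (open_unit_disc (d e)))
          (subtopology X e) (\<Phi> e)) \<and>
     (\<forall>e\<in>E. \<exists>F. finite F \<and> F \<subseteq> {f\<in>E. d f < d e} \<and>
        \<Phi> e ` (unit_disc (d e) - open_unit_disc (d e)) \<subseteq> \<Union>F) \<and>
     (\<forall>A \<subseteq> topspace X. (\<forall>e\<in>E. closedin X (A \<inter> X closure_of e)) \<longrightarrow> closedin X A)"

definition cw_complex :: "'a topology \<Rightarrow> bool" where
  "cw_complex X \<longleftrightarrow> (\<exists>E d \<Phi>. cw_structure X E d \<Phi>)"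


section \<open>The order topology of a tree\<close>

lemma is_treeD:
  assumes "is_tree T r"
  shows "refl_on T r" "r \<subseteq> T \<times> T" "trans r" "antisym r"
  using assms unfolding is_tree_def partial_order_on_def preorder_on_def by auto

lemma tree_refl:
  assumes "is_tree T r" "x \<in> T"
  shows "(x, x) \<in> r"
  using is_treeD(1)[OF assms(1)] assms(2) by (auto simp: refl_on_def)

lemma tree_carrier:
  assumes "is_tree T r" "(x, y) \<in> r"
  shows "x \<in> T" "y \<in> T"
  using is_treeD(2)[OF assms(1)] assms(2) by auto

lemma tree_trans:
  assumes "is_tree T r" "(x, y) \<in> r" "(y, z) \<in> r"
  shows "(x, z) \<in> r"
  using is_treeD(3)[OF assms(1)] assms(2,3) by (rule transD)

lemma underSD:
  assumes "is_tree T r" "a \<in> underS r x"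
  shows "(a, x) \<in> r" "(x, a) \<notin> r" "a \<in> T" "x \<in> T"
  using assms tree_carrier[OF assms(1)] antisymD[OF is_treeD(4)[OF assms(1)], of a x]
  by (auto simp: underS_def)

lemma underS_le_trans:
  assumes "is_tree T r" "a \<in> underS r x" "(x, y) \<in> r"
  shows "a \<in> underS r y"
proof -
  have "(a, y) \<in> r" "a \<noteq> y"
    using underSD[OF assms(1,2)] tree_trans[OF assms(1)] assms(3) by metis+
  then show ?thesis by (simp add: underS_def)
qed

lemma le_underS_trans:
  assumes "is_tree T r" "(a, x) \<in> r" "x \<in> underS r y"
  shows "a \<in> underS r y"
proof -
  have "(a, y) \<in> r" "a \<noteq> y"
    using underSD[OF assms(1,3)] tree_trans[OF assms(1)] assms(2) by metis+
  then show ?thesis by (simp add: underS_def)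
qed

lemma underS_upper:
  assumes tr: "is_tree T r" and a: "a \<in> underS r x" and b: "b \<in> underS r x"
  obtains m where "m \<in> underS r x" "(a, m) \<in> r" "(b, m) \<in> r"
proof -
  have "total_on (underS r x) (Restr r (underS r x))"
    using tr underSD(4)[OF tr a]
    by (auto simp: is_tree_def well_order_on_def linear_order_on_def)
  then have "(a, b) \<in> r \<or> (b, a) \<in> r \<or> a = b"
    using a b unfolding total_on_def by auto
  then show ?thesis
    using that a b tree_refl[OF tr] underSD(3)[OF tr] by metis
qed

text \<open>Minimal points are isolated, and the intervals below a non-minimal point form a
  neighbourhood basis at it.\<close>

lemma openin_tree_topology:
  assumes tr: "is_tree T r"
  shows "openin (tree_topology T r) U \<longleftrightarrow> U \<subseteq> T \<and>
    (\<forall>x\<in>U. underS r x \<noteq> {} \<longrightarrow> (\<exists>z\<in>underS r x. tree_interval r z x \<subseteq> U))"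
    (is "_ \<longleftrightarrow> ?P U")
proof
  let ?B = "{{x} |x. x \<in> T \<and> underS r x = {}} \<union>
      {tree_interval r z x |z x. x \<in> T \<and> z \<in> underS r x}"
  assume "openin (tree_topology T r) U"
  then have "generate_topology_on ?B U"
    unfolding tree_topology_def by (rule openin_topology_generated_by)
  then show "?P U"
  proof induction
    case Empty
    then show ?case by simp
  next
    case (Int a b)
    show ?case
    proof (intro conjI ballI impI)
      show "a \<inter> b \<subseteq> T" using Int by auto
      fix x assume x: "x \<in> a \<inter> b" "underS r x \<noteq> {}"
      obtain z where z: "z \<in> underS r x" "tree_interval r z x \<subseteq> a"
        using Int.IH(1) x by blast
      obtain z' where z': "z' \<in> underS r x" "tree_interval r z' x \<subseteq> b"
        using Int.IH(2) x by blast
      obtain m where m: "m \<in> underS r x" "(z, m) \<in> r" "(z', m) \<in> r"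
        using underS_upper[OF tr z(1) z'(1)] .
      have "tree_interval r m x \<subseteq> tree_interval r z x \<inter> tree_interval r z' x"
        using m le_underS_trans[OF tr] by (auto simp: tree_interval_def)
      then show "\<exists>z\<in>underS r x. tree_interval r z x \<subseteq> a \<inter> b"
        using m(1) z(2) z'(2) by (intro bexI[of _ m]) auto
    qed
  next
    case (UN K)
    show ?case
    proof (intro conjI ballI impI)
      show "\<Union>K \<subseteq> T" using UN by auto
      fix x assume x: "x \<in> \<Union>K" "underS r x \<noteq> {}"
      then obtain k where k: "k \<in> K" "x \<in> k" by auto
      then obtain z where "z \<in> underS r x" "tree_interval r z x \<subseteq> k"
        using UN.IH[OF k(1)] k(2) x(2) by blast
      then show "\<exists>z\<in>underS r x. tree_interval r z x \<subseteq> \<Union>K"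
        using k(1) by (intro bexI[of _ z]) auto
    qed
  next
    case (Basis s)
    then consider x where "s = {x}" "x \<in> T" "underS r x = {}"
      | z x where "s = tree_interval r z x" "x \<in> T" "z \<in> underS r x"
      by auto
    then show ?case
    proof cases
      case 1
      then show ?thesis by auto
    next
      case 2
      have "z \<in> underS r w \<and> tree_interval r z w \<subseteq> s" if "w \<in> s" for w
        using 2 that tree_trans[OF tr] by (auto simp: tree_interval_def)
      moreover have "s \<subseteq> T"
        using 2 tree_carrier[OF tr] by (auto simp: tree_interval_def)
      ultimately show ?thesis by blast
    qed
  qed
next
  assume P: "?P U"
  have "\<exists>V. openin (tree_topology T r) V \<and> x \<in> V \<and> V \<subseteq> U" if x: "x \<in> U" for x
  proof (cases "underS r x = {}")
    case True
    then have "openin (tree_topology T r) {x}"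
      using P x unfolding tree_topology_def by (intro topology_generated_by_Basis) auto
    then show ?thesis using x by auto
  next
    case False
    then obtain z where z: "z \<in> underS r x" "tree_interval r z x \<subseteq> U" using P x by blast
    have "openin (tree_topology T r) (tree_interval r z x)"
      using P x z unfolding tree_topology_def by (intro topology_generated_by_Basis) auto
    moreover have "x \<in> tree_interval r z x"
      using z underSD[OF tr] tree_refl[OF tr] by (auto simp: tree_interval_def)
    ultimately show ?thesis using z by auto
  qed
  then show "openin (tree_topology T r) U"
    by (subst openin_subopen) auto
qed

lemma openin_tree_interval:
  assumes tr: "is_tree T r"
  shows "openin (tree_topology T r) (tree_interval r z x)"
  unfolding openin_tree_topology[OF tr]
proof (intro conjI ballI impI)
  show "tree_interval r z x \<subseteq> T"
    using tree_carrier[OF tr] by (auto simp: tree_interval_def)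
  fix w assume "w \<in> tree_interval r z x"
  then show "\<exists>y\<in>underS r w. tree_interval r y w \<subseteq> tree_interval r z x"
    using tree_trans[OF tr] by (intro bexI[of _ z]) (auto simp: tree_interval_def)
qed

lemma openin_tree_down:
  assumes tr: "is_tree T r"
  shows "openin (tree_topology T r) {w. (w, x) \<in> r}"
  unfolding openin_tree_topology[OF tr]
proof (intro conjI ballI impI)
  show "{w. (w, x) \<in> r} \<subseteq> T"
    using tree_carrier[OF tr] by auto
  fix w assume w: "w \<in> {w. (w, x) \<in> r}" "underS r w \<noteq> {}"
  then obtain z where "z \<in> underS r w" by auto
  then show "\<exists>y\<in>underS r w. tree_interval r y w \<subseteq> {w. (w, x) \<in> r}"
    using w(1) tree_trans[OF tr] by (intro bexI[of _ z]) (auto simp: tree_interval_def)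
qed

lemma topspace_tree_topology:
  assumes tr: "is_tree T r"
  shows "topspace (tree_topology T r) = T"
proof (rule antisym)
  show "topspace (tree_topology T r) \<subseteq> T"
    using openin_topspace[of "tree_topology T r"] unfolding openin_tree_topology[OF tr] by (rule conjunct1)
  show "T \<subseteq> topspace (tree_topology T r)"
  proof
    fix x assume "x \<in> T"
    then show "x \<in> topspace (tree_topology T r)"
      using openin_subset[OF openin_tree_down[OF tr, of x]] tree_refl[OF tr, of x] by auto
  qed
qed

text \<open>The Hausdorff condition says that two points at the same limit level with the same
  predecessors are equal.\<close>

lemma Hausdorff_tree_topology_iff:
  assumes tr: "is_tree T r"
  shows "Hausdorff_space (tree_topology T r) \<longleftrightarrow>
    (\<forall>x\<in>T. \<forall>y\<in>T. underS r x = underS r y \<and> underS r x \<noteq> {} \<and>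
       (\<forall>m\<in>underS r x. \<exists>w\<in>underS r x. m \<in> underS r w) \<longrightarrow> x = y)"
    (is "?H \<longleftrightarrow> ?L")
proof
  assume H: ?H
  show ?L
  proof (intro ballI impI, elim conjE, rule ccontr)
    fix x y
    assume x: "x \<in> T" "y \<in> T" and eq: "underS r x = underS r y" and ne: "underS r x \<noteq> {}"
      and lim: "\<forall>m\<in>underS r x. \<exists>w\<in>underS r x. m \<in> underS r w" and "x \<noteq> y"
    then obtain U V where UV: "openin (tree_topology T r) U" "openin (tree_topology T r) V"
      "x \<in> U" "y \<in> V" "disjnt U V"
      using H unfolding Hausdorff_space_def topspace_tree_topology[OF tr] by metis
    obtain z where z: "z \<in> underS r x" "tree_interval r z x \<subseteq> U"
      using UV(1,3) ne unfolding openin_tree_topology[OF tr] by blast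
    obtain z' where z': "z' \<in> underS r x" "tree_interval r z' y \<subseteq> V"
      using UV(2,4) ne eq unfolding openin_tree_topology[OF tr] by blast
    obtain m where m: "m \<in> underS r x" "(z, m) \<in> r" "(z', m) \<in> r"
      using underS_upper[OF tr z(1) z'(1)] .
    then obtain w where w: "w \<in> underS r x" "m \<in> underS r w" using lim by auto
    have "z \<in> underS r w" "z' \<in> underS r w"
      using m w le_underS_trans[OF tr] by auto
    moreover have "(w, x) \<in> r" "(w, y) \<in> r"
      using w(1) eq underSD(1)[OF tr] by auto
    ultimately have "w \<in> U" "w \<in> V"
      using z(2) z'(2) by (auto simp: tree_interval_def)
    then show False using UV(5) by (auto simp: disjnt_def)
  qed
next
  assume L: ?L
  let ?S = "\<lambda>x y. \<exists>U V. openin (tree_topology T r) U \<and> openin (tree_topology T r) V \<and>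
      x \<in> U \<and> y \<in> V \<and> disjnt U V"
  have selfI: "x \<in> tree_interval r z x" if "z \<in> underS r x" for z x
    using that underSD[OF tr] tree_refl[OF tr] by (auto simp: tree_interval_def)
  have sep1: "?S x y" if "z \<in> underS r x" "(z, y) \<notin> r" "y \<in> T" for x y z
  proof (intro exI conjI)
    show "disjnt (tree_interval r z x) {w. (w, y) \<in> r}"
      using that(2) tree_trans[OF tr underSD(1)[OF tr]]
      by (auto simp: disjnt_def tree_interval_def)
  qed (use that openin_tree_interval[OF tr] openin_tree_down[OF tr] selfI tree_refl[OF tr] in auto)
  have sep2: "?S x y" if "x \<in> underS r y" for x y
  proof (intro exI conjI)
    show "disjnt {w. (w, x) \<in> r} (tree_interval r x y)"
      using underSD(2)[OF tr] by (auto simp: disjnt_def tree_interval_def)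
  qed (use that openin_tree_interval[OF tr] openin_tree_down[OF tr] selfI tree_refl[OF tr]
        underSD[OF tr] in auto)
  have sym: "?S y x" if "?S x y" for x y
  proof -
    from that obtain U V where "openin (tree_topology T r) U" "openin (tree_topology T r) V"
      "x \<in> U" "y \<in> V" "disjnt U V" by blast
    then show ?thesis using disjnt_sym[of U V] by blast
  qed
  have "?S x y" if xy: "x \<in> T" "y \<in> T" "x \<noteq> y" for x y
  proof (cases "x \<in> underS r y \<or> y \<in> underS r x")
    case True
    then show ?thesis using sep2[of x y] sym[OF sep2[of y x]] by argo
  next
    case inc: False
    show ?thesis
    proof (cases "underS r x = underS r y")
      case False
      then consider z where "z \<in> underS r x" "z \<notin> underS r y"
        | z where "z \<in> underS r y" "z \<notin> underS r x" by auto
      then show ?thesis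
      proof cases
        case 1
        then have "(z, y) \<notin> r" using inc by (auto simp: underS_def)
        then show ?thesis using sep1[of z x y] 1 xy by simp
      next
        case 2
        then have "(z, x) \<notin> r" using inc by (auto simp: underS_def)
        then show ?thesis using sym[OF sep1[of z y x]] 2 xy by simp
      qed
    next
      case eq: True
      have iso: "openin (tree_topology T r) {u}" if u: "u \<in> T"
          and m: "underS r u = {} \<or> (\<exists>m\<in>underS r u. \<forall>w\<in>underS r u. m \<notin> underS r w)" for u
      proof -
        have "tree_interval r m u \<subseteq> {u}"
          if "\<forall>w\<in>underS r u. m \<notin> underS r w" for m
          using that by (auto simp: tree_interval_def underS_def)
        then show ?thesis using m u unfolding openin_tree_topology[OF tr] by blast
      qed
      have m: "underS r x = {} \<or> (\<exists>m\<in>underS r x. \<forall>w\<in>underS r x. m \<notin> underS r w)"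
        using L xy eq by metis
      show ?thesis
      proof (intro exI conjI)
        show "openin (tree_topology T r) {x}" using iso[OF xy(1) m] .
        show "openin (tree_topology T r) {y}" using iso[OF xy(2)] m eq by simp
        show "disjnt {x} {y}" using xy by (simp add: disjnt_def)
      qed auto
    qed
  qed
  then show ?H unfolding Hausdorff_space_def topspace_tree_topology[OF tr] by simp
qed

end

theory Submission
  imports Defs "HOL-Library.Countable_Set_Type"
begin

text \<open>
  Let \<open>S\<close> be an uncountable \<open>\<omega>\<^sub>1\<close>-compact subset of the tree. A point \<open>x\<close> is in the \<^emph>\<open>trunk\<close> of \<open>S\<close>
  if the cone \<open>S \<inter> above r x\<close> is uncountable, and cones over trunk points play the role of
  conditions in a forcing argument. Two facts make them behave well.

  First, antichains of a tree are closed and discrete, so those of \<open>S\<close> are countable. Hence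
  countably many up-closed subsets of the trunk can be decided at once: above any trunk point there is
  a trunk point \<open>x\<close> that belongs to every one of these sets that meets the trunk above \<open>x\<close>
  (\<open>decide_up_closed_sets\<close>).

  Second, \<open>S\<close> satisfies a pressing down lemma: a function that assigns to all but countably many
  points of \<open>S\<close> a strict predecessor has an uncountable fibre (\<open>omega1_compact_stationary\<close>). This
  gives a common limit point for countably many sets each of which meets every cone.

  Together they yield \<open>countable_family_of_closed_sets\<close>: given countably many closed subsets of
  \<open>S\<close>, some cone contains a point that lies in every one of these sets that meets the cone. Applied to the
  sets \<open>f \<le> q\<close> and \<open>f \<ge> q\<close> with \<open>q\<close> rational this shows that countably many continuous real functions
  are simultaneously constant on some cone (\<open>real_functions_constant\<close>). A set with
  one point in each cell of a CW-complex is closed and discrete, so a map from \<open>S\<close> to a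
  CW-complex meets countably many cells only; each cell is a countable union of compact subsets of
  Euclidean space, and the map is therefore constant on an uncountable closed subset
  (\<open>constant_into_cw_complex\<close>).

  If the manifold \<open>M\<close> were homotopy equivalent to a CW-complex, the inclusion of \<open>S\<close> into \<open>M\<close>
  would be homotopic to a map that factors through the complex, and the
  latter is constant on an uncountable closed set. Constancy on a cone then propagates along the homotopy
  (\<open>homotopy_stays_constant\<close>): it survives limits of times because \<open>M\<close> is Hausdorff, and
  it extends beyond any time before the end because, on a smaller cone, the homotopy stays inside a single chart
  for a while, where \<open>real_functions_constant\<close> applies to the coordinates. At the end, the inclusion itself
  would be constant on an uncountable cone. The case of a Suslin tree follows, because a tree
  whose antichains are countable is \<open>\<omega>\<^sub>1\<close>-compact (\<open>ccc_imp_omega1_compact\<close>).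
\<close>

section \<open>Closed discrete sets\<close>

text \<open>
  Local finiteness in its sharpest form. It is easier to verify than discreteness and closedness one after
  the other, and every set that \<open>\<omega>\<^sub>1\<close>-compactness is applied to below satisfies it.
\<close>
lemma closed_discreteI:
  assumes T1: "t1_space X" and D: "D \<subseteq> topspace X"
    and sparse: "\<And>p. p \<in> topspace X \<Longrightarrow> \<exists>U d. openin X U \<and> p \<in> U \<and> U \<inter> D \<subseteq> {d}"
  shows "closedin X D" "subtopology X D = discrete_topology D"
proof -
  have sub: "closedin X B" if B: "B \<subseteq> D" for B
  proof -
    have "\<exists>V. openin X V \<and> p \<in> V \<and> V \<subseteq> topspace X - B" if p: "p \<in> topspace X - B" for p
    proof -
      obtain U d where U: "openin X U" "p \<in> U" "U \<inter> D \<subseteq> {d}" using sparse p by blast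
      show ?thesis
      proof (cases "d \<in> B")
        case True
        then have "closedin X {d}" using T1 B D by (simp add: closedin_t1_singleton subset_iff)
        then have "openin X (U - {d})" using U(1) by (rule openin_diff[rotated])
        then show ?thesis using True U p B openin_subset[OF U(1)]
          by (intro exI[of _ "U - {d}"]) auto
      next
        case False
        then show ?thesis using U B openin_subset[OF U(1)] by (intro exI[of _ U]) auto
      qed
    qed
    then have "openin X (topspace X - B)" by (subst openin_subopen) blast
    then show ?thesis using B D by (simp add: closedin_def)
  qed
  show "closedin X D" by (rule sub) simp
  have "openin (subtopology X D) {d}" if "d \<in> D" for d
  proof -
    have "closedin (subtopology X D) (D - {d})"
      using sub[of "D - {d}"] by (auto simp: closedin_subtopology)
    then show ?thesis using that D by (auto simp: closedin_def topspace_subtopology Int_absorb1 double_diff)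
  qed
  then show "subtopology X D = discrete_topology D"
    using D by (subst eq_commute, subst discrete_topology_unique) (auto simp: topspace_subtopology)
qed

lemma omega1_compactD:
  assumes "omega1_compact X" "t1_space X" "D \<subseteq> topspace X"
    and "\<And>p. p \<in> topspace X \<Longrightarrow> \<exists>U d. openin X U \<and> p \<in> U \<and> U \<inter> D \<subseteq> {d}"
  shows "countable D"
  using assms closed_discreteI[of X D] by (auto simp: omega1_compact_def)

lemma omega1_compact_closed_subset:
  assumes X: "omega1_compact (subtopology X S)" and C: "closedin (subtopology X S) C"
  shows "omega1_compact (subtopology X C)"
  unfolding omega1_compact_def
proof (intro allI impI, elim conjE)
  fix D assume D: "closedin (subtopology X C) D" "subtopology (subtopology X C) D = discrete_topology D"
  have CS: "C \<subseteq> S" using closedin_subset[OF C] by (simp add: topspace_subtopology)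
  then have eq: "subtopology (subtopology X S) C = subtopology X C"
    by (simp add: subtopology_subtopology Int_absorb1)
  have "closedin (subtopology X S) D"
    using D(1) C closedin_trans_full[of "subtopology X S" C D] eq by simp
  moreover have "D \<subseteq> C" using closedin_subset[OF D(1)] by (simp add: topspace_subtopology)
  then have "subtopology (subtopology X S) D = discrete_topology D"
    using D(2) CS by (simp add: subtopology_subtopology Int_absorb1 Int_absorb2)
  ultimately show "countable D" using X by (auto simp: omega1_compact_def)
qed


section \<open>Trees with countable initial segments\<close>

text \<open>
  What \<open>\<omega>\<^sub>1\<close>-trees and Suslin trees have in common. The sets studied in them
  are moreover assumed to have countable antichains only, which covers
  the \<open>\<omega>\<^sub>1\<close>-compact sets as well as Suslin trees.
\<close>
locale short_tree =
  fixes T :: "'a set" and r :: "'a rel"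
  assumes hausdorff: "hausdorff_tree T r"
    and countable_underS: "x \<in> T \<Longrightarrow> countable (underS r x)"
begin

lemma tree: "is_tree T r"
  using hausdorff by (simp add: hausdorff_tree_def)

lemmas le_refl = tree_refl[OF tree]
lemmas le_trans = tree_trans[OF tree]
lemmas le_carrier = tree_carrier[OF tree]
lemmas underS_dest = underSD[OF tree]

lemma countable_strictly_below: "countable (underS r x)"
proof (cases "x \<in> T")
  case False
  then have "underS r x = {}" using le_carrier by (auto simp: underS_def)
  then show ?thesis by simp
qed (rule countable_underS)

lemma le_iff: "(a, x) \<in> r \<longleftrightarrow> a \<in> underS r x \<or> (a = x \<and> x \<in> T)"
  using le_refl le_carrier by (auto simp: underS_def)

lemma le_comparable:
  assumes "(a, x) \<in> r" "(b, x) \<in> r"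
  shows "(a, b) \<in> r \<or> (b, a) \<in> r"
proof (cases "a = x \<or> b = x")
  case False
  then have *: "a \<in> underS r x" "b \<in> underS r x" using assms by (auto simp: underS_def)
  then have "total_on (underS r x) (Restr r (underS r x))"
    using tree underS_dest(4) by (auto simp: is_tree_def well_order_on_def linear_order_on_def)
  then have "(a, b) \<in> r \<or> (b, a) \<in> r \<or> a = b" using * unfolding total_on_def by auto
  then show ?thesis using le_refl underS_dest(3)[OF *(1)] by auto
qed (use assms in auto)

lemma minimal_below:
  assumes y: "y \<in> U" and U: "U \<subseteq> T"
  obtains m where "m \<in> U" "(m, y) \<in> r" "underS r m \<inter> U = {}"
proof (cases "underS r y \<inter> U = {}")
  case True
  then show ?thesis using that y U le_refl by blast
next
  case False
  let ?w = "Restr r (underS r y)"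
  have "wf (?w - Id)" using tree y U by (auto simp: is_tree_def well_order_on_def)
  moreover obtain q where "q \<in> underS r y \<inter> U" using False by auto
  ultimately obtain m where m: "m \<in> underS r y \<inter> U"
    and min: "\<And>q. (q, m) \<in> ?w - Id \<Longrightarrow> q \<notin> underS r y \<inter> U"
    by (rule wfE_min) auto
  have "q \<notin> U" if "q \<in> underS r m" for q
  proof -
    have "q \<in> underS r y"
      using that m underS_le_trans[OF tree] underS_dest(1) by blast
    then show ?thesis using min[of q] that m by (auto simp: underS_def)
  qed
  then show ?thesis using that m underS_dest(1) by blast
qed

abbreviation \<tau> :: "'a topology" where "\<tau> \<equiv> tree_topology T r"

lemma topspace_\<tau> [simp]: "topspace \<tau> = T"
  by (rule topspace_tree_topology[OF tree])

lemma t1_sub: "t1_space (subtopology \<tau> S)"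
  using hausdorff by (simp add: hausdorff_tree_def Hausdorff_imp_t1_space t1_space_subtopology)

lemma closedin_above: "closedin \<tau> (above r x)"
proof -
  have "openin \<tau> (T - above r x)"
    unfolding openin_tree_topology[OF tree] above_def
  proof (intro conjI ballI impI)
    fix w assume w: "w \<in> T - {b. (x, b) \<in> r}" "underS r w \<noteq> {}"
    then obtain z where "z \<in> underS r w" by auto
    moreover have "tree_interval r z w \<subseteq> T - {b. (x, b) \<in> r}"
      using w le_trans le_carrier by (auto simp: tree_interval_def)
    ultimately show "\<exists>z\<in>underS r w. tree_interval r z w \<subseteq> T - {b. (x, b) \<in> r}" by blast
  qed auto
  moreover have "above r x \<subseteq> T" using le_carrier by (auto simp: above_def)
  ultimately show ?thesis by (simp add: closedin_def)
qed

text \<open>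
  The point \<open>p\<close> and its predecessors form an open neighbourhood of \<open>p\<close>, and being a chain they contain at most one
  point of an antichain.
\<close>
lemma countable_antichain:
  assumes S: "S \<subseteq> T" and comp: "omega1_compact (subtopology \<tau> S)"
    and A: "tree_antichain T r A" "A \<subseteq> S"
  shows "countable A"
proof (rule omega1_compactD[OF comp t1_sub])
  show "A \<subseteq> topspace (subtopology \<tau> S)" using A S by (auto simp: topspace_subtopology)
  fix p assume p: "p \<in> topspace (subtopology \<tau> S)"
  have "\<exists>d. {w. (w, p) \<in> r} \<inter> A \<subseteq> {d}"
  proof (cases "{w. (w, p) \<in> r} \<inter> A = {}")
    case False
    then obtain d where d: "(d, p) \<in> r" "d \<in> A" by auto
    have "w = d" if "(w, p) \<in> r" "w \<in> A" for w
      using le_comparable[OF that(1) d(1)] A(1) that(2) d(2) by (auto simp: tree_antichain_def)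
    then show ?thesis by blast
  qed simp
  then obtain d where "{w. (w, p) \<in> r} \<inter> A \<subseteq> {d}" ..
  moreover have "openin (subtopology \<tau> S) (S \<inter> {w. (w, p) \<in> r})"
    using openin_tree_down[OF tree] by (simp add: openin_subtopology_Int2)
  ultimately show "\<exists>U d. openin (subtopology \<tau> S) U \<and> p \<in> U \<and> U \<inter> A \<subseteq> {d}"
    using p le_refl by (intro exI[of _ "S \<inter> {w. (w, p) \<in> r}"] exI[of _ d])
      (auto simp: topspace_subtopology)
qed

definition ccc :: "'a set \<Rightarrow> bool" where
  "ccc S \<longleftrightarrow> S \<subseteq> T \<and> (\<forall>A\<subseteq>S. tree_antichain T r A \<longrightarrow> countable A)"

lemma ccc_subset: "ccc S \<Longrightarrow> S' \<subseteq> S \<Longrightarrow> ccc S'"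
  by (auto simp: ccc_def)

text \<open>
  Minimal elements of a set form an antichain, and choosing a point of \<open>S\<close> above each of them gives an
  antichain of \<open>S\<close>. This is the device through which countability of antichains is used throughout.
\<close>
lemma countable_minimal_elements:
  assumes S: "ccc S" and reach: "\<And>q. q \<in> U \<Longrightarrow> S \<inter> above r q \<noteq> {}"
  shows "countable {q \<in> U. underS r q \<inter> U = {}}" (is "countable ?Q")
proof -
  have "\<forall>q\<in>U. \<exists>s. s \<in> S \<and> (q, s) \<in> r" using reach by (auto simp: above_def)
  then obtain f where f: "\<And>q. q \<in> U \<Longrightarrow> f q \<in> S" "\<And>q. q \<in> U \<Longrightarrow> (q, f q) \<in> r" by metis
  have eq: "q = q'" if "q \<in> ?Q" "q' \<in> ?Q" "(f q, f q') \<in> r" for q q'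
  proof -
    have "(q, f q') \<in> r" "(q', f q') \<in> r" using f(2) that le_trans by blast+
    then have "(q, q') \<in> r \<or> (q', q) \<in> r" by (rule le_comparable)
    then show ?thesis using that(1,2) by (auto simp: le_iff)
  qed
  have "tree_antichain T r (f ` ?Q)"
    unfolding tree_antichain_def
  proof (intro conjI ballI impI)
    show "f ` ?Q \<subseteq> T" using S f(1) by (auto simp: ccc_def)
    fix x y assume xy: "x \<in> f ` ?Q" "y \<in> f ` ?Q" "x \<noteq> y"
    then show "(x, y) \<notin> r" "(y, x) \<notin> r" using eq by blast+
  qed
  moreover have "f ` ?Q \<subseteq> S" using f(1) by auto
  ultimately have "countable (f ` ?Q)" using S by (simp add: ccc_def)
  moreover have "inj_on f ?Q"
  proof (rule inj_onI)
    fix q q' assume *: "q \<in> ?Q" "q' \<in> ?Q" "f q = f q'"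
    then have "f q \<in> T" using f(1)[of q] S by (auto simp: ccc_def)
    then have "(f q, f q') \<in> r" using le_refl *(3) by metis
    then show "q = q'" using eq * by blast
  qed
  ultimately show ?thesis by (metis countable_image_inj_on)
qed

definition trunk :: "'a set \<Rightarrow> 'a set" where
  "trunk S = {x \<in> T. uncountable (S \<inter> above r x)}"

lemma trunk_down: "x \<in> trunk S \<Longrightarrow> (y, x) \<in> r \<Longrightarrow> y \<in> trunk S"
proof -
  assume x: "x \<in> trunk S" and yx: "(y, x) \<in> r"
  have "S \<inter> above r x \<subseteq> S \<inter> above r y" using le_trans yx by (auto simp: above_def)
  then show "y \<in> trunk S" using x le_carrier(1)[OF yx] countable_subset unfolding trunk_def by blast
qed

text \<open>
  The points outside the trunk lie above the minimal ones that still have points of \<open>S\<close> above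
  them: countably many cones, each with countably many points of \<open>S\<close>.
\<close>
lemma countable_off_trunk:
  assumes S: "ccc S"
  shows "countable (S - trunk S)"
proof -
  have ST: "S \<subseteq> T" using S by (simp add: ccc_def)
  define U where "U = {q \<in> T. q \<notin> trunk S \<and> S \<inter> above r q \<noteq> {}}"
  define Q where "Q = {q \<in> U. underS r q \<inter> U = {}}"
  have "countable Q" unfolding Q_def
    by (rule countable_minimal_elements[OF S]) (auto simp: U_def)
  moreover have "countable (S \<inter> above r q)" if "q \<in> Q" for q
    using that by (auto simp: Q_def U_def trunk_def)
  moreover have "S - trunk S \<subseteq> (\<Union>q\<in>Q. S \<inter> above r q)"
  proof
    fix s assume s: "s \<in> S - trunk S"
    then have "s \<in> U" using ST le_refl by (auto simp: U_def above_def)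
    moreover have "U \<subseteq> T" by (auto simp: U_def)
    ultimately obtain m where "m \<in> U" "(m, s) \<in> r" "underS r m \<inter> U = {}"
      by (rule minimal_below)
    then show "s \<in> (\<Union>q\<in>Q. S \<inter> above r q)" using s by (auto simp: Q_def above_def)
  qed
  ultimately show ?thesis by (meson countable_UN countable_subset)
qed

text \<open>
  The minimal elements of all the sets \<open>U i\<close> within the trunk are countably many, so \<open>x\<close> can be chosen
  outside the countably many points below them. If then some \<open>y\<close> above \<open>x\<close> is in \<open>U i\<close>, the minimal element
  of \<open>U i\<close> below \<open>y\<close> is comparable with \<open>x\<close>, and it cannot be strictly above \<open>x\<close>.
\<close>
lemma decide_up_closed_sets:
  fixes U :: "'i::countable \<Rightarrow> 'a set"
  assumes S: "ccc S" and x0: "x0 \<in> trunk S"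
    and up: "\<And>i x y. x \<in> U i \<Longrightarrow> (x, y) \<in> r \<Longrightarrow> y \<in> trunk S \<Longrightarrow> y \<in> U i"
  obtains x where "x \<in> S" "x \<in> trunk S" "(x0, x) \<in> r"
    "\<And>i y. y \<in> U i \<Longrightarrow> y \<in> trunk S \<Longrightarrow> (x, y) \<in> r \<Longrightarrow> x \<in> U i"
proof -
  define Q where "Q i = {q \<in> U i \<inter> trunk S. underS r q \<inter> (U i \<inter> trunk S) = {}}" for i
  have "countable (Q i)" for i
    unfolding Q_def by (rule countable_minimal_elements[OF S]) (metis IntD2 countable_empty mem_Collect_eq trunk_def)
  then have "countable ((S - trunk S) \<union> (\<Union>i. \<Union>q\<in>Q i. underS r q))"
    using countable_off_trunk[OF S] countable_strictly_below by auto
  moreover have "uncountable (S \<inter> above r x0)" using x0 by (simp add: trunk_def)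
  ultimately obtain x where x: "x \<in> S" "(x0, x) \<in> r" "x \<in> trunk S"
      and xQ: "\<And>i q. q \<in> Q i \<Longrightarrow> x \<notin> underS r q"
  proof -
    assume c: "countable ((S - trunk S) \<union> (\<Union>i. \<Union>q\<in>Q i. underS r q))" (is "countable ?P")
      and u: "uncountable (S \<inter> above r x0)"
    have "\<not> S \<inter> above r x0 \<subseteq> ?P" using c u countable_subset by blast
    then show ?thesis using that by (auto simp: above_def)
  qed
  have "x \<in> U i" if y: "y \<in> U i" "y \<in> trunk S" "(x, y) \<in> r" for i y
  proof -
    have "U i \<inter> trunk S \<subseteq> T" by (auto simp: trunk_def)
    then obtain m where m: "m \<in> U i \<inter> trunk S" "(m, y) \<in> r" "underS r m \<inter> (U i \<inter> trunk S) = {}"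
      using y minimal_below[of y "U i \<inter> trunk S"] by blast
    then have "x \<notin> underS r m" using xQ by (auto simp: Q_def)
    then have "(m, x) \<in> r" using le_comparable[OF m(2) y(3)] le_iff by blast
    then show ?thesis using up m x by blast
  qed
  then show ?thesis using that x by blast
qed

section \<open>Pressing down\<close>

text \<open>
  The conclusion of the pressing down lemma. For a subset of the tree \<open>\<omega>\<^sub>1\<close> and
  regressive functions this is the usual characterization of stationarity, except that here
  countable sets also count as stationary.
\<close>
definition stationary :: "'a set \<Rightarrow> bool" where
  "stationary S \<longleftrightarrow> (\<forall>N z. countable N \<and> (\<forall>s\<in>S - N. z s \<in> underS r s) \<and>
     (\<forall>t. countable {s \<in> S - N. z s = t}) \<longrightarrow> countable S)"

lemma uncountable_fibre:
  assumes S: "stationary S" "uncountable S" and N: "countable N"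
    and z: "\<forall>s\<in>S - N. z s \<in> underS r s"
  shows "\<exists>t. uncountable {s \<in> S - N. z s = t}"
  using S(1)[unfolded stationary_def, rule_format, of N z] S(2) N z by auto

text \<open>
  A set closed under \<open>step S z\<close> is closed under predecessors and contains, with each point \<open>t\<close>, the
  fibre of \<open>z\<close> over \<open>t\<close>. Such sets take the part of the initial segments of a tree whose height lies in a
  closed unbounded set of ordinals closed under \<open>z\<close>; being generated by a relation, they form a family closed
  under arbitrary unions.
\<close>
definition step :: "'a set \<Rightarrow> ('a \<Rightarrow> 'a) \<Rightarrow> 'a rel" where
  "step S z = {(a, b). b \<in> underS r a \<or> (b \<in> S \<and> z b = a)}"

lemma countable_closure:
  assumes "\<And>t. countable {s \<in> S. z s = t}" "countable A"
  shows "countable ((step S z)\<^sup>* `` A)"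
proof (rule countable_rtrancl)
  fix Y :: "'a set" assume "countable Y"
  moreover have "step S z `` Y = (\<Union>a\<in>Y. underS r a \<union> {s \<in> S. z s = a})"
    by (auto simp: step_def)
  ultimately show "countable (step S z `` Y)" using assms(1) countable_strictly_below by auto
qed (rule assms)

lemma closure_down:
  assumes "b \<in> (step S z)\<^sup>* `` A" "(a, b) \<in> r"
  shows "a \<in> (step S z)\<^sup>* `` A"
proof (cases "a = b")
  case False
  then have "(b, a) \<in> step S z" using assms by (auto simp: step_def underS_def)
  then show ?thesis using assms(1) by (meson Image_iff rtrancl.rtrancl_into_rtrancl)
qed (use assms in simp)

lemma closure_fibre:
  assumes "z s \<in> (step S z)\<^sup>* `` A" "s \<in> S"
  shows "s \<in> (step S z)\<^sup>* `` A"
proof -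
  have "(z s, s) \<in> step S z" using assms by (auto simp: step_def)
  then show ?thesis using assms(1) by (meson Image_iff rtrancl.rtrancl_into_rtrancl)
qed

text \<open>
  If all fibres are countable, then so is the closure \<open>P\<close> of \<open>N\<close>. A minimal point \<open>m\<close> of \<open>S\<close> outside
  \<open>P\<close> would have \<open>z m\<close> in \<open>P\<close>, hence lie in \<open>P\<close> itself.
\<close>
lemma down_closed_stationary:
  assumes S: "S \<subseteq> T" and down: "\<And>x y. x \<in> S \<Longrightarrow> (y, x) \<in> r \<Longrightarrow> y \<in> S"
  shows "stationary S"
  unfolding stationary_def
proof (intro allI impI, elim conjE)
  fix N z
  assume N: "countable N" and z: "\<forall>s\<in>S - N. z s \<in> underS r s"
    and fib: "\<forall>t. countable {s \<in> S - N. z s = t}"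
  define P where "P = (step (S - N) z)\<^sup>* `` N"
  have "countable P" unfolding P_def using fib N by (intro countable_closure) auto
  moreover have "S \<subseteq> P"
  proof (rule ccontr)
    assume "\<not> S \<subseteq> P"
    then obtain p where "p \<in> S - P" by auto
    moreover have "S - P \<subseteq> T" using S by auto
    ultimately obtain m where m: "m \<in> S - P" "underS r m \<inter> (S - P) = {}"
      by (rule minimal_below)
    then have mN: "m \<in> S - N" by (auto simp: P_def)
    then have "z m \<in> underS r m" using z by auto
    then have "z m \<in> P" using m down underS_dest(1) by blast
    then have "m \<in> P" unfolding P_def using closure_fibre mN by blast
    then show False using m by simp
  qed
  ultimately show "countable S" by (metis countable_subset)
qed

text \<open>
  For arbitrary \<open>S\<close> the minimal point just used need not belong to \<open>S\<close>. Suppose that all fibres are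
  countable, and list \<open>S\<close> in a well-order. The closures \<open>P s\<close> of the initial segments of the list increase
  continuously. No point \<open>p\<close> of \<open>S\<close> outside a closed set \<open>Q\<close> is a limit of points of \<open>Q\<close>, because
  \<open>z p\<close> lies outside \<open>Q\<close> as well. So the set \<open>D\<close> of those \<open>s\<close> that are new, that is not in \<open>P s\<close>, has no
  limit point in \<open>S\<close>. By \<open>\<omega>\<^sub>1\<close>-compactness \<open>D\<close> is countable, and the closure of
  \<open>N \<union> D\<close> contains the whole list.
\<close>
lemma omega1_compact_stationary:
  assumes S: "S \<subseteq> T" and comp: "omega1_compact (subtopology \<tau> S)"
  shows "stationary S"
  unfolding stationary_def
proof (intro allI impI, elim conjE)
  fix N z
  assume N: "countable N" and z: "\<forall>s\<in>S - N. z s \<in> underS r s"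
    and fib: "\<forall>t. countable {s \<in> S - N. z s = t}"
  define cl where "cl A = (step (S - N) z)\<^sup>* `` A" for A
  have cl_countable: "countable (cl A)" if "countable A" for A
    unfolding cl_def using fib that by (intro countable_closure) auto
  have cl_Un: "cl (A \<union> B) = cl A \<union> cl B" for A B by (auto simp: cl_def)
  have cl_mono: "A \<subseteq> B \<Longrightarrow> cl A \<subseteq> cl B" for A B by (auto simp: cl_def)
  have cl_sup: "A \<subseteq> cl A" for A by (auto simp: cl_def)
  have cl_pt: "p \<in> cl A \<longleftrightarrow> (\<exists>a\<in>A. p \<in> cl {a})" for p A by (auto simp: cl_def)
  have jump: "tree_interval r (z p) p \<inter> cl (N \<union> A) = {} \<and> p \<in> tree_interval r (z p) p"
    if p: "p \<in> S" "p \<notin> cl (N \<union> A)" for p A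
  proof -
    have pN: "p \<in> S - N" using p cl_sup[of "N \<union> A"] by auto
    then have zp: "z p \<in> underS r p" using z by auto
    have "z p \<notin> cl (N \<union> A)" using p pN closure_fibre unfolding cl_def by blast
    then have "tree_interval r (z p) p \<inter> cl (N \<union> A) = {}"
      using closure_down underS_dest(1) unfolding cl_def tree_interval_def by blast
    then show ?thesis using zp p S le_refl by (auto simp: tree_interval_def)
  qed
  obtain w where w: "well_order_on S w" using well_order_on by blast
  have w_lin: "trans w" "antisym w" "total_on S w" "w \<subseteq> S \<times> S" "wf (w - Id)"
    using w by (auto simp: well_order_on_def linear_order_on_def partial_order_on_def preorder_on_def)
  \<comment> \<open>Only the first \<open>\<omega>\<^sub>1\<close> points of the list matter: if \<open>S1\<close> is countable, then the
    first point not in \<open>S1\<close> would have countably many predecessors and so belong to \<open>S1\<close>.\<close>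
  define S1 where "S1 = {s \<in> S. countable (underS w s)}"
  have S1_down: "underS w s \<subseteq> S1" if "s \<in> S1" for s
  proof
    fix t assume t: "t \<in> underS w s"
    then have "underS w t \<subseteq> underS w s" using w_lin by (auto simp: underS_def dest: transD antisymD)
    then show "t \<in> S1" using that t w_lin countable_subset by (auto simp: S1_def underS_def)
  qed
  define P where "P s = cl (N \<union> underS w s)" for s
  define D where "D = {s \<in> S1. s \<notin> P s}"
  have "countable D"
  proof (rule omega1_compactD[OF comp t1_sub])
    show "D \<subseteq> topspace (subtopology \<tau> S)" using S by (auto simp: D_def S1_def topspace_subtopology)
    fix p assume "p \<in> topspace (subtopology \<tau> S)"
    then have p: "p \<in> S" by (simp add: topspace_subtopology)
    have "\<exists>U d. openin \<tau> U \<and> p \<in> U \<and> U \<inter> D \<subseteq> {d}"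
    proof (cases "p \<in> cl N")
      case True
      have "{w. (w, p) \<in> r} \<subseteq> cl N" using True closure_down unfolding cl_def by blast
      moreover have "cl N \<subseteq> P d" for d unfolding P_def by (rule cl_mono) auto
      ultimately have "{w. (w, p) \<in> r} \<inter> D \<subseteq> {p}" by (auto simp: D_def)
      then show ?thesis using openin_tree_down[OF tree] p S le_refl
        by (intro exI[of _ "{w. (w, p) \<in> r}"] exI[of _ p]) auto
    next
      case notN: False
      show ?thesis
      proof (cases "p \<in> cl S1")
        case False
        then have "p \<notin> cl (N \<union> S1)" using notN cl_Un by auto
        note j = jump[OF p this]
        moreover have "D \<subseteq> cl (N \<union> S1)" using cl_sup[of "N \<union> S1"] by (auto simp: D_def)
        ultimately have "tree_interval r (z p) p \<inter> D \<subseteq> {p}" by auto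
        then show ?thesis using openin_tree_interval[OF tree] j by blast
      next
        case True
        define G where "G = {t \<in> S1. p \<in> cl {t}}"
        have "G \<noteq> {}" using True cl_pt[of p S1] by (auto simp: G_def)
        then obtain g where "g \<in> G" by auto
        \<comment> \<open>The first \<open>t\<close> whose closure captures \<open>p\<close>: the neighbourhood given by \<open>jump\<close> avoids everything
          generated before \<open>t\<close> and lies in what \<open>t\<close> generates, so it contains no
          new point except possibly \<open>t\<close>.\<close>
        from wfE_min[OF w_lin(5) this] obtain t where t: "t \<in> G"
          and tmin: "\<And>u. (u, t) \<in> w - Id \<Longrightarrow> u \<notin> G" by blast
        have "p \<notin> cl (underS w t)"
        proof
          assume "p \<in> cl (underS w t)"
          then obtain u where u: "u \<in> underS w t" "p \<in> cl {u}" using cl_pt by blast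
          then have "u \<in> G" using S1_down t by (auto simp: G_def)
          then show False using tmin u by (auto simp: underS_def)
        qed
        then have "p \<notin> P t" using notN cl_Un by (auto simp: P_def)
        then have j: "tree_interval r (z p) p \<inter> P t = {}" "p \<in> tree_interval r (z p) p"
          using jump[OF p, of "underS w t"] by (auto simp: P_def)
        have "d = t" if d: "d \<in> tree_interval r (z p) p" "d \<in> D" for d
        proof (rule ccontr)
          assume ne: "d \<noteq> t"
          have dS: "d \<in> S" "t \<in> S" using d t by (auto simp: D_def S1_def G_def)
          then consider "t \<in> underS w d" | "d \<in> underS w t"
            using w_lin(3) ne by (auto simp: total_on_def underS_def)
          then show False
          proof cases
            case 1
            have "d \<in> cl {t}" using d t closure_down unfolding G_def cl_def tree_interval_def by blast
            then have "d \<in> P d" using 1 cl_pt[of d "N \<union> underS w d"] by (auto simp: P_def)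
            then show False using d by (simp add: D_def)
          next
            case 2
            then have "d \<in> P t" using cl_sup[of "N \<union> underS w t"] by (auto simp: P_def)
            then show False using d j by auto
          qed
        qed
        then have "tree_interval r (z p) p \<inter> D \<subseteq> {t}" by auto
        then show ?thesis using openin_tree_interval[OF tree] j by blast
      qed
    qed
    then obtain U d where "openin \<tau> U" "p \<in> U" "U \<inter> D \<subseteq> {d}" by blast
    then show "\<exists>U d. openin (subtopology \<tau> S) U \<and> p \<in> U \<and> U \<inter> D \<subseteq> {d}"
      using p by (intro exI[of _ "S \<inter> U"] exI[of _ d]) (auto simp: openin_subtopology_Int2)
  qed
  then have "countable (cl (N \<union> D))" using N by (intro cl_countable) auto
  moreover have "s \<in> S1 \<longrightarrow> s \<in> cl (N \<union> D)" for s
  proof (induction s rule: wf_induct[OF w_lin(5)])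
    case (1 s)
    show ?case
    proof (intro impI, cases "s \<in> D")
      case True
      then show "s \<in> cl (N \<union> D)" using cl_sup by blast
    next
      case False
      assume s: "s \<in> S1"
      have "underS w s \<subseteq> cl (N \<union> D)" using 1 S1_down[OF s] by (auto simp: underS_def)
      then have "N \<union> underS w s \<subseteq> cl (N \<union> D)" using cl_sup by blast
      moreover have "cl (cl (N \<union> D)) = cl (N \<union> D)"
        by (auto simp: cl_def intro: rtrancl_trans)
      ultimately have "P s \<subseteq> cl (N \<union> D)" unfolding P_def using cl_mono by metis
      then show "s \<in> cl (N \<union> D)" using False s by (auto simp: D_def)
    qed
  qed
  ultimately have cS1: "countable S1" by (meson countable_subset subsetI)
  have "S \<subseteq> S1"
  proof
    fix s show "s \<in> S \<Longrightarrow> s \<in> S1"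
    proof (induction s rule: wf_induct[OF w_lin(5)])
      case (1 s)
      then have "underS w s \<subseteq> S1" using w_lin(4) by (auto simp: underS_def)
      then show ?case using 1 cS1 countable_subset by (auto simp: S1_def)
    qed
  qed
  then show "countable S" using cS1 by (rule countable_subset)
qed

text \<open>
  Otherwise each \<open>p\<close> has an index \<open>i p\<close> and a predecessor \<open>z p\<close> with no point of \<open>C (i p)\<close> strictly
  between \<open>z p\<close> and \<open>p\<close>. Pressing down makes both constant on an uncountable set. The minimal points of
  the single set \<open>C j\<close> above \<open>t\<close> are countably many, so some \<open>s\<close> in the uncountable set is not below any of them;
  but \<open>C j\<close> has points above \<open>s\<close>, and a minimal point below one of these lies strictly between \<open>t\<close> and \<open>s\<close>.
\<close>
lemma common_limit_point:
  fixes C :: "'i::countable \<Rightarrow> 'a set"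
  assumes S: "stationary S" "uncountable S" and N: "countable N"
    and C: "\<And>i. ccc (C i)"
    and meet: "\<And>i p. p \<in> S - N \<Longrightarrow> C i \<inter> above r p \<noteq> {}"
  obtains p where "p \<in> S - N" "\<And>i z. z \<in> underS r p \<Longrightarrow> \<exists>c\<in>C i. z \<in> underS r c \<and> c \<in> underS r p"
proof (rule ccontr)
  assume "\<not> thesis"
  then have "\<forall>p\<in>S - N. \<exists>i z. z \<in> underS r p \<and> (\<forall>c\<in>C i. z \<in> underS r c \<longrightarrow> c \<notin> underS r p)"
    using that by meson
  then obtain i z where z: "\<And>p. p \<in> S - N \<Longrightarrow> z p \<in> underS r p"
    and iz: "\<And>p c. p \<in> S - N \<Longrightarrow> c \<in> C (i p) \<Longrightarrow> z p \<in> underS r c \<Longrightarrow> c \<notin> underS r p"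
    by metis
  obtain t where t: "uncountable {s \<in> S - N. z s = t}"
    using uncountable_fibre[OF S N] z by blast
  let ?F = "\<lambda>j. {s \<in> S - N. z s = t \<and> i s = j}"
  have "\<exists>j. uncountable (?F j)"
  proof (rule ccontr)
    assume "\<not> (\<exists>j. uncountable (?F j))"
    then have "countable (\<Union>j. ?F j)" by (intro countable_UN) auto
    moreover have "(\<Union>j. ?F j) = {s \<in> S - N. z s = t}" by auto
    ultimately show False using t by simp
  qed
  then obtain j where W: "uncountable {s \<in> S - N. z s = t \<and> i s = j}" (is "uncountable ?W") ..
  define U where "U = {c \<in> C j. t \<in> underS r c}"
  define A where "A = {q \<in> U. underS r q \<inter> U = {}}"
  have UT: "U \<subseteq> T" using C by (auto simp: U_def ccc_def)
  have "countable A" unfolding A_def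
  proof (rule countable_minimal_elements[OF C[of j]])
    fix q assume "q \<in> U"
    then have "q \<in> C j \<inter> above r q" using UT le_refl by (auto simp: U_def above_def)
    then show "C j \<inter> above r q \<noteq> {}" by blast
  qed
  then have "countable (A \<union> (\<Union>a\<in>A. underS r a))" using countable_strictly_below by auto
  then have "\<not> ?W \<subseteq> A \<union> (\<Union>a\<in>A. underS r a)" using W countable_subset by metis
  then obtain s where "s \<in> ?W" "s \<notin> A \<union> (\<Union>a\<in>A. underS r a)" unfolding subset_iff by meson
  then have s: "s \<in> S - N" "z s = t" "i s = j" "s \<notin> A" "\<And>a. a \<in> A \<Longrightarrow> s \<notin> underS r a"
    by auto
  obtain c where c: "c \<in> C j" "(s, c) \<in> r" using meet[OF s(1), of j] by (auto simp: above_def)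
  have "t \<in> underS r c" using z[OF s(1)] s(2) c(2) underS_le_trans[OF tree] by blast
  then have "c \<in> U" using c by (simp add: U_def)
  then obtain a where a: "a \<in> U" "(a, c) \<in> r" "underS r a \<inter> U = {}"
    using UT by (rule minimal_below)
  then have "a \<in> A" by (simp add: A_def)
  then have "a \<in> underS r s" using le_comparable[OF a(2) c(2)] s(4,5) le_iff by blast
  then show False using iz[OF s(1), of a] s a by (auto simp: U_def)
qed

lemma omega1_compact_ccc:
  assumes "S \<subseteq> T" "omega1_compact (subtopology \<tau> S)"
  shows "ccc S"
  using assms countable_antichain by (simp add: ccc_def)

lemma countable_roots:
  assumes "ccc S"
  shows "countable {s \<in> S. underS r s = {}}"
proof -
  have "tree_antichain T r {s \<in> S. underS r s = {}}"
    using assms by (auto simp: tree_antichain_def ccc_def le_iff)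
  moreover have "{s \<in> S. underS r s = {}} \<subseteq> S" by auto
  ultimately show ?thesis using assms by (simp add: ccc_def)
qed

lemma uncountable_Int_trunk:
  assumes "ccc S" "uncountable S"
  shows "uncountable (S \<inter> trunk S)"
proof
  assume "countable (S \<inter> trunk S)"
  then have "countable ((S \<inter> trunk S) \<union> (S - trunk S))"
    using countable_off_trunk[OF assms(1)] by simp
  then show False using assms(2) by (simp add: Un_Diff_Int Int_Diff_Un)
qed

section \<open>Closed sets and continuous functions on cones\<close>
lemma closedin_Int_above: "closedin (subtopology \<tau> S) (S \<inter> above r x)"
  using closedin_above by (simp add: closedin_subtopology_Int_closed)

lemma in_closed_of_limit:
  assumes p: "p \<in> S" "S \<subseteq> T" "underS r p \<noteq> {}"
    and C: "closedin (subtopology \<tau> S) C"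
    and lim: "\<And>z. z \<in> underS r p \<Longrightarrow> \<exists>c\<in>C. z \<in> underS r c \<and> c \<in> underS r p"
  shows "p \<in> C"
proof (rule ccontr)
  assume "p \<notin> C"
  have CS: "C \<subseteq> S" using closedin_subset[OF C] by (auto simp: topspace_subtopology)
  have "openin (subtopology \<tau> S) (S - C)"
    using C p(2) by (auto simp: closedin_def topspace_subtopology Int_absorb1)
  then obtain V where V: "openin \<tau> V" "S - C = V \<inter> S" by (auto simp: openin_subtopology)
  then have "p \<in> V" using p \<open>p \<notin> C\<close> by auto
  then obtain z where z: "z \<in> underS r p" "tree_interval r z p \<subseteq> V"
    using V(1) p(3) unfolding openin_tree_topology[OF tree] by blast
  obtain c where c: "c \<in> C" "z \<in> underS r c" "c \<in> underS r p" using lim[OF z(1)] by blast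
  then have "c \<in> V" using z(2) underS_dest(1) by (auto simp: tree_interval_def)
  then show False using c CS V by blast
qed

text \<open>
  Choose \<open>x\<close> that decides, for every \<open>i\<close>, whether some smaller cone misses \<open>C i\<close>. Those \<open>C i\<close> that meet
  the cone over \<open>x\<close> then meet every cone inside it, so they have a common limit point there.
\<close>
lemma countable_family_of_closed_sets:
  fixes C :: "'i::countable \<Rightarrow> 'a set"
  assumes S: "S \<subseteq> T" and comp: "omega1_compact (subtopology \<tau> S)"
    and x0: "x0 \<in> trunk S" and C: "\<And>i. closedin (subtopology \<tau> S) (C i)"
  obtains x p where "x \<in> S" "x \<in> trunk S" "(x0, x) \<in> r" "p \<in> S \<inter> above r x"
    "\<And>i. C i \<inter> above r x \<noteq> {} \<Longrightarrow> p \<in> C i"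
proof -
  have ccc: "ccc S" by (rule omega1_compact_ccc[OF S comp])
  have CS: "C i \<subseteq> S" for i using closedin_subset[OF C] by (auto simp: topspace_subtopology)
  have up: "y \<in> {y. C i \<inter> above r y = {}}" if "x \<in> {y. C i \<inter> above r y = {}}" "(x, y) \<in> r" for i x y
    using that le_trans by (auto simp: above_def)
  obtain x where x: "x \<in> S" "x \<in> trunk S" "(x0, x) \<in> r"
    and dec: "\<And>i y. y \<in> {y. C i \<inter> above r y = {}} \<Longrightarrow> y \<in> trunk S \<Longrightarrow> (x, y) \<in> r \<Longrightarrow>
      x \<in> {y. C i \<inter> above r y = {}}"
    by (rule decide_up_closed_sets[OF ccc x0, of "\<lambda>i. {y. C i \<inter> above r y = {}}"]) (use up in blast)+
  let ?S = "S \<inter> above r x"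
  define N where "N = (S - trunk S) \<union> {s \<in> S. underS r s = {}}"
  \<comment> \<open>The sets that miss the cone are replaced by \<open>S\<close>, which imposes no condition.\<close>
  define C' where "C' i = (if C i \<inter> above r x \<noteq> {} then C i else S)" for i
  have st: "stationary ?S"
    using S omega1_compact_closed_subset[OF comp closedin_Int_above]
    by (intro omega1_compact_stationary) auto
  have un: "uncountable ?S" using x by (simp add: trunk_def)
  have N: "countable N"
    using countable_off_trunk[OF ccc] countable_roots[OF ccc] by (simp add: N_def)
  have C'c: "ccc (C' i)" for i using ccc_subset[OF ccc CS] ccc by (simp add: C'_def)
  have meet: "C' i \<inter> above r p \<noteq> {}" if p: "p \<in> ?S - N" for i p
  proof (cases "C i \<inter> above r x = {}")
    case True
    have "p \<in> S \<inter> above r p" using p S le_refl by (auto simp: above_def)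
    then show ?thesis using True by (auto simp: C'_def)
  next
    case False
    then show ?thesis using p dec[of p i] by (auto simp: C'_def N_def above_def)
  qed
  obtain p where p: "p \<in> ?S - N"
    and lim: "\<And>i z. z \<in> underS r p \<Longrightarrow> \<exists>c\<in>C' i. z \<in> underS r c \<and> c \<in> underS r p"
    by (rule common_limit_point[where C = C', OF st un N C'c meet]) blast+
  have "p \<in> C i" if "C i \<inter> above r x \<noteq> {}" for i
  proof (rule in_closed_of_limit[OF _ S _ C])
    show "p \<in> S" "underS r p \<noteq> {}" using p by (auto simp: N_def)
    show "\<exists>c\<in>C i. z \<in> underS r c \<and> c \<in> underS r p" if "z \<in> underS r p" for z
      using lim[OF that, of i] \<open>C i \<inter> above r x \<noteq> {}\<close> by (simp add: C'_def)
  qed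
  then show ?thesis using that x p by blast
qed

text \<open>
  A covering property: if countably many open sets cover \<open>S\<close>, then one of them contains a whole cone.
\<close>
lemma avoid_closed_set:
  fixes C :: "'i::countable \<Rightarrow> 'a set"
  assumes S: "S \<subseteq> T" and comp: "omega1_compact (subtopology \<tau> S)"
    and x0: "x0 \<in> trunk S" and C: "\<And>i. closedin (subtopology \<tau> S) (C i)"
    and empty: "(\<Inter>i. C i) = {}"
  obtains x i where "x \<in> S" "x \<in> trunk S" "(x0, x) \<in> r" "C i \<inter> above r x = {}"
proof -
  obtain x p where "x \<in> S" "x \<in> trunk S" "(x0, x) \<in> r" "\<And>i. C i \<inter> above r x \<noteq> {} \<Longrightarrow> p \<in> C i"
    by (rule countable_family_of_closed_sets[where C = C, OF S comp x0 C]) blast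
  moreover obtain i where "p \<notin> C i" using empty by blast
  ultimately show ?thesis using that by blast
qed

text \<open>
  Two different values of \<open>f i\<close> on a cone are separated by a rational number \<open>q\<close>. So if a point \<open>p\<close> lies in every set
  \<open>f i \<le> q\<close> or \<open>f i \<ge> q\<close> that meets the cone, no value on the cone can differ from \<open>f i p\<close>.
\<close>
lemma real_functions_constant:
  fixes f :: "'i::countable \<Rightarrow> 'a \<Rightarrow> real"
  assumes S: "S \<subseteq> T" and comp: "omega1_compact (subtopology \<tau> S)"
    and x0: "x0 \<in> trunk S" and f: "\<And>i. continuous_map (subtopology \<tau> S) euclideanreal (f i)"
  obtains x where "x \<in> S" "x \<in> trunk S" "(x0, x) \<in> r"
    "\<And>i s s'. s \<in> S \<inter> above r x \<Longrightarrow> s' \<in> S \<inter> above r x \<Longrightarrow> f i s = f i s'"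
proof -
  define C where "C = (\<lambda>(i, q :: rat, b). {s \<in> S. if b then f i s \<le> of_rat q else of_rat q \<le> f i s})"
  have C: "closedin (subtopology \<tau> S) (C j)" for j
  proof -
    obtain i q b where j: "j = (i, q, b)" by (cases j)
    have "closedin (subtopology \<tau> S) {s \<in> topspace (subtopology \<tau> S). f i s \<in> (if b then {..of_rat q} else {of_rat q..})}"
      by (rule closedin_continuous_map_preimage[OF f]) auto
    moreover have "{s \<in> topspace (subtopology \<tau> S). f i s \<in> (if b then {..of_rat q} else {of_rat q..})} = C j"
      using S by (auto simp: C_def j topspace_subtopology)
    ultimately show ?thesis by simp
  qed
  obtain x p where x: "x \<in> S" "x \<in> trunk S" "(x0, x) \<in> r" and p: "p \<in> S \<inter> above r x"
    and pC: "\<And>j. C j \<inter> above r x \<noteq> {} \<Longrightarrow> p \<in> C j"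
    by (rule countable_family_of_closed_sets[where C = C, OF S comp x0 C]) blast
  have "f i s = f i p" if s: "s \<in> S \<inter> above r x" for i s
  proof (rule ccontr)
    assume "f i s \<noteq> f i p"
    then consider "f i s < f i p" | "f i p < f i s" by linarith
    then show False
    proof cases
      case 1
      then obtain q where q: "f i s < of_rat q" "of_rat q < f i p" using of_rat_dense by blast
      then have "s \<in> C (i, q, True)" using s by (auto simp: C_def)
      then have "p \<in> C (i, q, True)" using s by (intro pC) auto
      then show False using q by (auto simp: C_def)
    next
      case 2
      then obtain q where q: "f i p < of_rat q" "of_rat q < f i s" using of_rat_dense by blast
      then have "s \<in> C (i, q, False)" using s by (auto simp: C_def)
      then have "p \<in> C (i, q, False)" using s by (intro pC) auto
      then show False using q by (auto simp: C_def)
    qed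
  qed
  then show ?thesis using that x by metis
qed

text \<open>
  The trunk of an uncountable set \<open>D\<close> is closed under predecessors, so pressing down holds for it, and \<open>D\<close> meets every
  cone over it. Hence \<open>D\<close> has a limit point and is not both closed and discrete.
\<close>
lemma ccc_imp_omega1_compact:
  assumes T: "ccc T"
  shows "omega1_compact \<tau>"
  unfolding omega1_compact_def
proof (intro allI impI, elim conjE, rule ccontr)
  fix D assume D: "closedin \<tau> D" "subtopology \<tau> D = discrete_topology D" and un: "uncountable D"
  have DT: "D \<subseteq> T" using closedin_subset[OF D(1)] by simp
  then have ccc: "ccc D" using T ccc_subset by blast
  have st: "stationary (trunk D)"
  proof (rule down_closed_stationary)
    show "trunk D \<subseteq> T" by (auto simp: trunk_def)
  qed (rule trunk_down)
  have un': "uncountable (trunk D)"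
    using uncountable_Int_trunk[OF ccc un] countable_subset[OF Int_lower2] by blast
  have meet: "D \<inter> above r p \<noteq> {}" if "p \<in> trunk D" for p
    using that unfolding trunk_def by (metis (mono_tags) countable_empty mem_Collect_eq)
  obtain p where p: "p \<in> trunk D - {s \<in> T. underS r s = {}}"
    and lim: "\<And>z. z \<in> underS r p \<Longrightarrow> \<exists>c\<in>D. z \<in> underS r c \<and> c \<in> underS r p"
    by (rule common_limit_point[OF st un' countable_roots[OF T], of "\<lambda>_::unit. D"])
      (use ccc meet in blast)+
  have pT: "p \<in> T" using p by (simp add: trunk_def)
  have "closedin (subtopology \<tau> D) (D - {p})" using D(2) by simp
  then have "closedin \<tau> (D - {p})" using D(1) by (rule closedin_trans_full)
  moreover have "subtopology \<tau> T = \<tau>" using subtopology_topspace[of \<tau>] by simp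
  ultimately have closed: "closedin (subtopology \<tau> T) (D - {p})" by simp
  have "p \<in> D - {p}"
  proof (rule in_closed_of_limit[OF pT _ _ closed])
    show "underS r p \<noteq> {}" using p pT by auto
    fix z assume "z \<in> underS r p"
    then obtain c where c: "c \<in> D" "z \<in> underS r c" "c \<in> underS r p" using lim by blast
    then have "c \<in> D - {p}" by (simp add: underS_def)
    then show "\<exists>c\<in>D - {p}. z \<in> underS r c \<and> c \<in> underS r p" using c by blast
  qed simp
  then show False by simp
qed

end

section \<open>Trees of height \<open>\<omega>\<^sub>1\<close>\<close>

context includes cardinal_syntax begin

lemma countable_below_omega1:
  assumes "(\<rho>, omega1) \<in> ordLess"
  shows "countable (Field \<rho>)"
proof -
  have "|Field \<rho>| \<le>o \<rho>" using assms by (intro card_of_least) (simp add: ordLess_def)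
  then have "|Field \<rho>| <o cardSuc natLeq"
    using assms ordLeq_ordLess_trans unfolding omega1_def by blast
  then have "|Field \<rho>| \<le>o natLeq"
    by (simp add: cardSuc_ordLeq_ordLess natLeq_Card_order card_of_Card_order)
  then show ?thesis by (simp add: countable_card_le_natLeq)
qed

lemma uncountable_Field_omega1: "uncountable (Field omega1)"
proof
  assume "countable (Field omega1)"
  then have "|Field omega1| \<le>o natLeq" by (simp add: countable_card_le_natLeq)
  moreover have "|Field omega1| =o omega1"
    unfolding omega1_def by (simp add: card_of_Field_ordIso cardSuc_Card_order natLeq_Card_order)
  moreover have "natLeq <o omega1"
    unfolding omega1_def by (simp add: cardSuc_greater natLeq_Card_order)
  ultimately show False
    by (meson not_ordLeq_ordLess ordIso_symmetric ordIso_ordLeq_trans)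
qed

lemma Restr_underS:
  assumes tr: "is_tree T r" and x: "x \<in> T"
  shows "Well_order (Restr r (underS r x))" "Field (Restr r (underS r x)) = underS r x"
proof -
  have w: "well_order_on (underS r x) (Restr r (underS r x))" using tr x by (simp add: is_tree_def)
  show "Field (Restr r (underS r x)) = underS r x" using well_order_on_Field[OF w] by simp
  then show "Well_order (Restr r (underS r x))" using w by simp
qed

text \<open>
  A point with uncountably many predecessors would have a point at level \<open>\<omega>\<^sub>1\<close> below or equal to it, since its
  predecessors are well ordered.
\<close>
lemma omega1_height_short_tree:
  assumes h: "hausdorff_tree T r" and ht: "has_tree_height T r omega1"
  shows "short_tree T r"
proof
  show "hausdorff_tree T r" by fact
  have tr: "is_tree T r" using h by (simp add: hausdorff_tree_def)
  fix x assume x: "x \<in> T"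
  let ?\<rho> = "Restr r (underS r x)"
  have wo: "Well_order omega1" using ht by (simp add: has_tree_height_def)
  have empty: "tree_level T r omega1 = {}" using ht by (simp add: has_tree_height_def)
  have "?\<rho> <o omega1"
  proof (rule ccontr)
    assume "\<not> ?\<rho> <o omega1"
    then have "omega1 \<le>o ?\<rho>" using wo Restr_underS(1)[OF tr x] not_ordLess_iff_ordLeq by blast
    then consider "omega1 =o ?\<rho>" | "omega1 <o ?\<rho>" using ordLeq_iff_ordLess_or_ordIso by blast
    then show False
    proof cases
      case 1
      then have "x \<in> tree_level T r omega1" using x ordIso_symmetric by (auto simp: tree_level_def)
      then show False using empty by simp
    next
      case 2
      then obtain a where a: "a \<in> Field ?\<rho>" "omega1 =o Restr ?\<rho> (underS ?\<rho> a)"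
        using ordLess_iff_ordIso_Restr[OF Restr_underS(1)[OF tr x] wo] by blast
      have ax: "a \<in> underS r x" using a(1) Restr_underS(2)[OF tr x] by simp
      have "underS ?\<rho> a = underS r a"
        using ax underS_le_trans[OF tr _ underSD(1)[OF tr ax]] by (auto simp: underS_def)
      moreover have "underS r a \<subseteq> underS r x"
        using underS_le_trans[OF tr _ underSD(1)[OF tr ax]] by auto
      ultimately have "Restr ?\<rho> (underS ?\<rho> a) = Restr r (underS r a)" by auto
      then have "a \<in> tree_level T r omega1"
        using a(2) ordIso_symmetric underSD(3)[OF tr ax] by (auto simp: tree_level_def)
      then show False using empty by simp
    qed
  qed
  then show "countable (underS r x)"
    using countable_below_omega1 Restr_underS(2)[OF tr x] by metis
qed

lemma omega1_height_uncountable: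
  assumes ht: "has_tree_height T r omega1"
  shows "uncountable T"
proof
  assume T: "countable T"
  have wo: "Well_order omega1" using ht by (simp add: has_tree_height_def)
  let ?seg = "\<lambda>a. Restr omega1 (underS omega1 a)"
  have seg: "?seg a <o omega1" if "a \<in> Field omega1" for a
    using underS_Restr_ordLess[OF wo] that by auto
  have "\<forall>a\<in>Field omega1. \<exists>x. x \<in> tree_level T r (?seg a)"
  proof
    fix a assume "a \<in> Field omega1"
    then have "tree_level T r (?seg a) \<noteq> {}" using ht seg unfolding has_tree_height_def by blast
    then show "\<exists>x. x \<in> tree_level T r (?seg a)" by blast
  qed
  then obtain x where x: "\<And>a. a \<in> Field omega1 \<Longrightarrow> x a \<in> tree_level T r (?seg a)" by metis
  have "inj_on x (Field omega1)"
  proof (rule inj_onI)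
    fix a b assume ab: "a \<in> Field omega1" "b \<in> Field omega1" "x a = x b"
    have iso: "?seg a =o ?seg b"
    proof (rule ordIso_transitive)
      show "?seg a =o Restr r (underS r (x a))"
        using x[OF ab(1)] by (simp add: tree_level_def ordIso_symmetric)
      show "Restr r (underS r (x a)) =o ?seg b"
        using x[OF ab(2)] ab(3) by (simp add: tree_level_def)
    qed
    have ne: False if "c \<in> underS omega1 d" "?seg c =o ?seg d \<or> ?seg d =o ?seg c" for c d
    proof -
      have w: "wo_rel omega1" using wo by (simp add: wo_rel_def)
      have "underS omega1 c \<subset> underS omega1 d"
      proof
        show "underS omega1 c \<subseteq> underS omega1 d"
          using that(1) underS_incr[OF wo_rel.TRANS[OF w] wo_rel.ANTISYM[OF w]]
          by (auto simp: underS_def)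
        show "underS omega1 c \<noteq> underS omega1 d" using that(1) by (auto simp: underS_def)
      qed
      then have "?seg c <o ?seg d"
        using ofilter_subset_ordLess[OF wo, of "underS omega1 c" "underS omega1 d"]
          wo_rel.underS_ofilter[OF w] by blast
      then show False using that(2) not_ordLess_ordIso ordIso_symmetric by blast
    qed
    show "a = b"
    proof (rule ccontr)
      assume "a \<noteq> b"
      then have "a \<in> underS omega1 b \<or> b \<in> underS omega1 a"
        using ab wo by (auto simp: well_order_on_def linear_order_on_def total_on_def underS_def)
      then show False using ne iso by blast
    qed
  qed
  moreover have "countable (x ` Field omega1)"
    by (rule countable_subset[OF _ T]) (use x in \<open>auto simp: tree_level_def\<close>)
  ultimately show False using uncountable_Field_omega1 countable_image_inj_on by blast
qed

end

section \<open>Maps into CW-complexes\<close>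

lemma Euclidean_space_coordinate:
  assumes "continuous_map Y (subtopology (Euclidean_space n) A) f"
  shows "continuous_map Y euclideanreal (\<lambda>y. f y i)"
proof -
  have "continuous_map Y (powertop_real UNIV) f"
    using assms unfolding Euclidean_space_def by (simp add: continuous_map_in_subtopology)
  then show ?thesis by (simp add: continuous_map_componentwise_UNIV)
qed

text \<open>
  The parameter \<open>c\<close> is the square of the radius; negative \<open>c\<close> gives the empty set.
\<close>
definition Euclidean_ball :: "nat \<Rightarrow> real \<Rightarrow> (nat \<Rightarrow> real) set" where
  "Euclidean_ball n c = {x \<in> topspace (Euclidean_space n). (\<Sum>i<n. (x i)\<^sup>2) \<le> c}"

lemma compactin_Euclidean_ball: "compactin (Euclidean_space n) (Euclidean_ball n c)"
proof -
  let ?P = "powertop_real (UNIV :: nat set)"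
  let ?K = "PiE UNIV (\<lambda>i. if i < n then {- sqrt c..sqrt c} else {0})"
  have "compactin ?P ?K" by (subst compactin_PiE) auto
  moreover have "Euclidean_ball n c \<subseteq> ?K"
  proof
    fix x assume x: "x \<in> Euclidean_ball n c"
    have "\<bar>x i\<bar> \<le> sqrt c" if i: "i < n" for i
    proof -
      have "(x i)\<^sup>2 \<le> (\<Sum>i<n. (x i)\<^sup>2)" using i by (intro member_le_sum) auto
      also have "\<dots> \<le> c" using x by (simp add: Euclidean_ball_def)
      finally show ?thesis using real_sqrt_le_mono real_sqrt_abs by metis
    qed
    then show "x \<in> ?K" using x by (auto simp: Euclidean_ball_def topspace_Euclidean_space abs_le_iff)
      (metis minus_le_iff)+
  qed
  moreover have "closedin ?P (Euclidean_ball n c)"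
  proof -
    have "continuous_on UNIV (\<lambda>x :: nat \<Rightarrow> real. \<Sum>i<n. (x i)\<^sup>2)"
      by (intro continuous_intros continuous_on_product_coordinates)
    then have "closed {x :: nat \<Rightarrow> real. (\<Sum>i<n. (x i)\<^sup>2) \<le> c}"
      by (intro closed_Collect_le continuous_intros) auto
    then have "closedin ?P {x. (\<Sum>i<n. (x i)\<^sup>2) \<le> c}"
      by (simp add: euclidean_product_topology)
    moreover have "Euclidean_ball n c = topspace (Euclidean_space n) \<inter> {x. (\<Sum>i<n. (x i)\<^sup>2) \<le> c}"
      by (auto simp: Euclidean_ball_def)
    ultimately show ?thesis using closedin_Euclidean_space[of n] by (simp add: closedin_Int)
  qed
  ultimately have "compactin ?P (Euclidean_ball n c)" by (rule closed_compactin)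
  then show ?thesis
    unfolding Euclidean_space_def by (auto simp: compactin_subtopology Euclidean_ball_def topspace_Euclidean_space)
qed

lemma open_unit_disc_exhaustion: "open_unit_disc n = (\<Union>k. Euclidean_ball n (1 - inverse (real (Suc k))))"
proof (intro antisym subsetI)
  fix x assume x: "x \<in> open_unit_disc n"
  then have "0 < 1 - (\<Sum>i<n. (x i)\<^sup>2)" by (simp add: open_unit_disc_def)
  then obtain k where "inverse (real (Suc k)) < 1 - (\<Sum>i<n. (x i)\<^sup>2)" using reals_Archimedean by blast
  then have "x \<in> Euclidean_ball n (1 - inverse (real (Suc k)))"
    using x by (simp add: Euclidean_ball_def open_unit_disc_def)
  then show "x \<in> (\<Union>k. Euclidean_ball n (1 - inverse (real (Suc k))))" by blast
next
  fix x assume "x \<in> (\<Union>k. Euclidean_ball n (1 - inverse (real (Suc k))))"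
  then obtain k where "x \<in> Euclidean_ball n (1 - inverse (real (Suc k)))" by blast
  moreover have "1 - inverse (real (Suc k)) < 1" by simp
  ultimately show "x \<in> open_unit_disc n" unfolding Euclidean_ball_def open_unit_disc_def by (auto simp: le_less_trans)
qed

locale cw_decomposition =
  fixes X :: "'x topology" and E d \<Phi>
  assumes cw: "cw_structure X E d \<Phi>"
begin

lemma X_Hausdorff: "Hausdorff_space X" and cells_cover: "\<Union>E = topspace X" and cells_disjoint: "disjoint E"
  using cw unfolding cw_structure_def by - ((elim conjE, assumption)+)

lemma characteristic_map:
  assumes "e \<in> E"
  shows "continuous_map (subtopology (Euclidean_space (d e)) (unit_disc (d e))) X (\<Phi> e)"
    "homeomorphic_map (subtopology (Euclidean_space (d e)) (open_unit_disc (d e))) (subtopology X e) (\<Phi> e)"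
proof -
  have "\<forall>e\<in>E. continuous_map (subtopology (Euclidean_space (d e)) (unit_disc (d e))) X (\<Phi> e) \<and>
        homeomorphic_map (subtopology (Euclidean_space (d e)) (open_unit_disc (d e)))
          (subtopology X e) (\<Phi> e)"
    using cw unfolding cw_structure_def by (elim conjE)
  then show "continuous_map (subtopology (Euclidean_space (d e)) (unit_disc (d e))) X (\<Phi> e)"
    "homeomorphic_map (subtopology (Euclidean_space (d e)) (open_unit_disc (d e))) (subtopology X e) (\<Phi> e)"
    using assms by blast+
qed

lemma boundary_finite:
  assumes "e \<in> E"
  obtains F where "finite F" "F \<subseteq> E" "\<Phi> e ` (unit_disc (d e) - open_unit_disc (d e)) \<subseteq> \<Union>F"
proof -
  have "\<forall>e\<in>E. \<exists>F. finite F \<and> F \<subseteq> {f\<in>E. d f < d e} \<and>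
        \<Phi> e ` (unit_disc (d e) - open_unit_disc (d e)) \<subseteq> \<Union>F"
    using cw unfolding cw_structure_def by (elim conjE)
  from bspec[OF this assms] obtain F where "finite F" "F \<subseteq> {f\<in>E. d f < d e}"
    "\<Phi> e ` (unit_disc (d e) - open_unit_disc (d e)) \<subseteq> \<Union>F"
    by (elim exE conjE)
  then show ?thesis using that[of F] by auto
qed

lemma weak_topology:
  assumes "A \<subseteq> topspace X" "\<And>e. e \<in> E \<Longrightarrow> closedin X (A \<inter> X closure_of e)"
  shows "closedin X A"
proof -
  have "\<forall>A \<subseteq> topspace X. (\<forall>e\<in>E. closedin X (A \<inter> X closure_of e)) \<longrightarrow> closedin X A"
    using cw unfolding cw_structure_def by (elim conjE)
  then show ?thesis using assms by blast
qed

lemma cell_image: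
  assumes "e \<in> E"
  shows "\<Phi> e ` open_unit_disc (d e) = e"
proof -
  have "open_unit_disc (d e) \<subseteq> topspace (Euclidean_space (d e))" by (auto simp: open_unit_disc_def)
  moreover have "e \<subseteq> topspace X" using cells_cover assms by auto
  ultimately show ?thesis
    using homeomorphic_imp_surjective_map[OF characteristic_map(2)[OF assms]]
    by (simp add: topspace_subtopology Int_absorb1)
qed

lemma closedin_image_ball:
  assumes e: "e \<in> E" and c: "c \<le> 1"
  shows "closedin X (\<Phi> e ` Euclidean_ball (d e) c)"
proof -
  have "Euclidean_ball (d e) c \<subseteq> unit_disc (d e)" using c by (auto simp: Euclidean_ball_def unit_disc_def)
  then have "compactin (subtopology (Euclidean_space (d e)) (unit_disc (d e))) (Euclidean_ball (d e) c)"
    using compactin_Euclidean_ball by (simp add: compactin_subtopology)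
  then have "compactin X (\<Phi> e ` Euclidean_ball (d e) c)"
    using characteristic_map(1)[OF e] by (rule image_compactin)
  then show ?thesis using X_Hausdorff by (rule compactin_imp_closedin[rotated])
qed

text \<open>
  The closure of a cell is the image of a compact disc, so by closure-finiteness it meets finitely many cells,
  hence finitely many points of \<open>B\<close>. The weak topology does the rest.
\<close>
lemma closedin_one_point_per_cell:
  assumes B: "B \<subseteq> topspace X" and one: "\<And>e. e \<in> E \<Longrightarrow> \<exists>b. B \<inter> e \<subseteq> {b}"
  shows "closedin X B"
proof (rule weak_topology[OF B])
  fix e assume e: "e \<in> E"
  obtain F where F: "finite F" "F \<subseteq> E" "\<Phi> e ` (unit_disc (d e) - open_unit_disc (d e)) \<subseteq> \<Union>F"
    using boundary_finite[OF e] .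
  have ud: "unit_disc (d e) = Euclidean_ball (d e) 1" by (simp add: unit_disc_def Euclidean_ball_def)
  have sub: "open_unit_disc (d e) \<subseteq> unit_disc (d e)" by (auto simp: unit_disc_def open_unit_disc_def)
  have "e \<subseteq> \<Phi> e ` unit_disc (d e)" using cell_image[OF e] sub by blast
  then have "X closure_of e \<subseteq> \<Phi> e ` unit_disc (d e)"
    using closedin_image_ball[OF e, of 1] by (intro closure_of_minimal) (simp_all add: ud)
  also have "\<dots> \<subseteq> \<Union>(insert e F)" using F(3) cell_image[OF e] by blast
  finally have "B \<inter> X closure_of e \<subseteq> (\<Union>f\<in>insert e F. B \<inter> f)" by blast
  moreover have "finite (B \<inter> f)" if "f \<in> insert e F" for f
  proof -
    have "f \<in> E" using that e F(2) by auto
    then obtain b where "B \<inter> f \<subseteq> {b}" using one by blast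
    then show ?thesis by (rule finite_subset) simp
  qed
  then have "finite (\<Union>f\<in>insert e F. B \<inter> f)" using F(1) by (intro finite_UN_I) auto
  ultimately have "finite (B \<inter> X closure_of e)" by (rule finite_subset)
  then show "closedin X (B \<inter> X closure_of e)"
    using B X_Hausdorff by (simp add: closedin_Hausdorff_finite le_infI1)
qed

text \<open>
  Pick one point of \<open>Y\<close> over each cell that is met. The images form a closed discrete set, as does every
  subset of it, so the chosen points have no limit point in \<open>Y\<close>.
\<close>
lemma countably_many_cells:
  assumes Y: "omega1_compact Y" "t1_space Y" and f: "continuous_map Y X f"
  shows "countable {e \<in> E. e \<inter> f ` topspace Y \<noteq> {}}"
proof -
  define E' where "E' = {e \<in> E. e \<inter> f ` topspace Y \<noteq> {}}"
  have E'E: "e \<in> E" if "e \<in> E'" for e using that by (simp add: E'_def)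
  have "\<forall>e\<in>E'. \<exists>y. y \<in> topspace Y \<and> f y \<in> e" by (auto simp: E'_def)
  then have "\<exists>c. \<forall>e\<in>E'. c e \<in> topspace Y \<and> f (c e) \<in> e" by (rule bchoice)
  then obtain c where c: "\<And>e. e \<in> E' \<Longrightarrow> c e \<in> topspace Y" "\<And>e. e \<in> E' \<Longrightarrow> f (c e) \<in> e" by blast
  have inj: "e = e'" if "e \<in> E'" "e' \<in> E'" "f (c e) = f (c e')" for e e'
    using c(2)[OF that(1)] c(2)[OF that(2)] that cells_disjoint
      E'E by (auto simp: pairwise_def disjnt_def)
  have fX: "f y \<in> topspace X" if "y \<in> topspace Y" for y
    using f that by (auto simp: continuous_map_def)
  have "countable (c ` E')"
  proof (rule omega1_compactD[OF Y])
    show "c ` E' \<subseteq> topspace Y" using c(1) by auto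
    fix p assume p: "p \<in> topspace Y"
    define B where "B = f ` c ` E' - {f p}"
    have "closedin X B"
    proof (rule closedin_one_point_per_cell)
      show "B \<subseteq> topspace X" using c(1) fX by (auto simp: B_def)
      fix e assume e: "e \<in> E"
      have "B \<inter> e \<subseteq> {f (c e)}"
      proof
        fix b assume b: "b \<in> B \<inter> e"
        then obtain e' where e': "e' \<in> E'" "b = f (c e')" by (auto simp: B_def)
        then have "b \<in> e'" using c(2) by blast
        then have "e' = e" using b e E'E[OF e'(1)] cells_disjoint by (auto simp: pairwise_def disjnt_def)
        then show "b \<in> {f (c e)}" using e' by simp
      qed
      then show "\<exists>b. B \<inter> e \<subseteq> {b}" by blast
    qed
    then have "openin X (topspace X - B)" by (rule openin_diff[OF openin_topspace])
    define V where "V = {y \<in> topspace Y. f y \<in> topspace X - B}"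
    have U: "openin Y V"
      unfolding V_def by (rule openin_continuous_map_preimage[OF f]) fact
    have pU: "p \<in> V" unfolding V_def using p fX[OF p] unfolding B_def by blast
    have "\<exists>q. V \<inter> c ` E' \<subseteq> {q}"
    proof (cases "\<exists>e\<in>E'. f (c e) = f p")
      case True
      then obtain e where e: "e \<in> E'" "f (c e) = f p" by blast
      have "V \<inter> c ` E' \<subseteq> {c e}"
      proof
        fix y assume y: "y \<in> V \<inter> c ` E'"
        then obtain e' where e': "e' \<in> E'" "y = c e'" by blast
        then have "f (c e') = f p" using y unfolding V_def B_def by blast
        then have "e' = e" using inj[OF e'(1) e(1)] e(2) by simp
        then show "y \<in> {c e}" using e'(2) by simp
      qed
      then show ?thesis by blast
    next
      case False
      then have "V \<inter> c ` E' = {}" unfolding V_def B_def by blast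
      then show ?thesis by simp
    qed
    then show "\<exists>U q. openin Y U \<and> p \<in> U \<and> U \<inter> c ` E' \<subseteq> {q}" using U pU by blast
  qed
  moreover have "inj_on c E'" using inj by (intro inj_onI) metis
  ultimately have "countable E'" by (metis countable_image_inj_on)
  then show ?thesis by (simp add: E'_def)
qed

text \<open>
  The functions \<open>h i\<close> are the coordinates of \<open>f\<close> in a cell \<open>e\<close>. The preimage of \<open>e\<close> need not be closed,
  but the preimages of the images of smaller closed discs are, and countably many of them cover \<open>Y\<close>.
\<close>
lemma euclidean_piece:
  assumes Y: "omega1_compact Y" "t1_space Y" and f: "continuous_map Y X f"
    and un: "uncountable (topspace Y)"
  obtains C h where "closedin Y C" "uncountable C"
    "\<And>i :: nat. continuous_map (subtopology Y C) euclideanreal (h i)"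
    "\<And>s s'. s \<in> C \<Longrightarrow> s' \<in> C \<Longrightarrow> (\<And>i. h i s = h i s') \<Longrightarrow> f s = f s'"
proof -
  define E' where "E' = {e \<in> E. e \<inter> f ` topspace Y \<noteq> {}}"
  define c where "c k = 1 - inverse (real (Suc k))" for k
  define C where "C e k = {y \<in> topspace Y. f y \<in> \<Phi> e ` Euclidean_ball (d e) (c k)}" for e k
  have c1: "c k \<le> 1" for k by (simp add: c_def)
  have fX: "f y \<in> topspace X" if "y \<in> topspace Y" for y
    using f that by (auto simp: continuous_map_def)
  have cell: "(\<Union>k. \<Phi> e ` Euclidean_ball (d e) (c k)) = e" if "e \<in> E" for e
    using cell_image[OF that] unfolding open_unit_disc_exhaustion c_def by blast
  have "topspace Y \<subseteq> (\<Union>e\<in>E'. \<Union>k. C e k)"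
  proof
    fix y assume y: "y \<in> topspace Y"
    then obtain e where e: "e \<in> E" "f y \<in> e" using fX cells_cover by blast
    then obtain k where "f y \<in> \<Phi> e ` Euclidean_ball (d e) (c k)" using cell[OF e(1)] by blast
    then show "y \<in> (\<Union>e\<in>E'. \<Union>k. C e k)" using e y unfolding C_def E'_def by blast
  qed
  then have unU: "uncountable (\<Union>e\<in>E'. \<Union>k. C e k)"
    using un countable_subset[of "topspace Y"] by metis
  have "\<exists>e\<in>E'. \<exists>k. uncountable (C e k)"
  proof (rule ccontr)
    assume "\<not> (\<exists>e\<in>E'. \<exists>k. uncountable (C e k))"
    moreover have "countable E'" unfolding E'_def by (rule countably_many_cells[OF Y f])
    ultimately have "countable (\<Union>e\<in>E'. \<Union>k. C e k)" by (intro countable_UN) auto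
    then show False using unU by simp
  qed
  then obtain e k where "e \<in> E'" and unC: "uncountable (C e k)" by blast
  then have e: "e \<in> E" by (simp add: E'_def)
  let ?D = "subtopology (Euclidean_space (d e)) (open_unit_disc (d e))"
  obtain \<Psi> where \<Psi>: "homeomorphic_maps ?D (subtopology X e) (\<Phi> e) \<Psi>"
    using characteristic_map(2)[OF e] by (auto simp: homeomorphic_map_maps)
  have closed: "closedin Y (C e k)"
    unfolding C_def by (intro closedin_continuous_map_preimage[OF f] closedin_image_ball e c1)
  have Ce: "f y \<in> e" if "y \<in> C e k" for y using that cell[OF e] by (auto simp: C_def)
  have "continuous_map (subtopology Y (C e k)) (subtopology X e) f"
    using f Ce by (auto simp: continuous_map_in_subtopology continuous_map_from_subtopology)
  moreover have "continuous_map (subtopology X e) ?D \<Psi>" using \<Psi> by (simp add: homeomorphic_maps_def)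
  ultimately have "continuous_map (subtopology Y (C e k)) ?D (\<Psi> \<circ> f)" by (rule continuous_map_compose)
  then have cont: "continuous_map (subtopology Y (C e k)) euclideanreal (\<lambda>y. (\<Psi> \<circ> f) y i)" for i
    by (rule Euclidean_space_coordinate)
  have inj: "f s = f s'" if s: "s \<in> C e k" "s' \<in> C e k" and eq: "\<And>i. (\<Psi> \<circ> f) s i = (\<Psi> \<circ> f) s' i" for s s'
  proof -
    have "f s \<in> topspace (subtopology X e)" "f s' \<in> topspace (subtopology X e)"
      using s Ce fX by (auto simp: C_def topspace_subtopology)
    moreover have "\<Psi> (f s) = \<Psi> (f s')" using eq by (simp add: fun_eq_iff)
    ultimately show ?thesis using \<Psi> by (metis homeomorphic_maps_def)
  qed
  show ?thesis
    by (rule that[where h = "\<lambda>i y. (\<Psi> \<circ> f) y i", OF closed unC cont inj])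
qed

end

context short_tree begin

lemma uncountable_trunk_nonempty:
  assumes "S \<subseteq> T" "omega1_compact (subtopology \<tau> S)" "uncountable S"
  obtains x where "x \<in> S" "x \<in> trunk S"
proof -
  have "uncountable (S \<inter> trunk S)"
    using uncountable_Int_trunk[OF omega1_compact_ccc[OF assms(1,2)] assms(3)] .
  then have "S \<inter> trunk S \<noteq> {}" by (metis countable_empty)
  then show ?thesis using that by blast
qed

text \<open>
  The closed set is a cone inside the closed piece of \<open>S\<close> on which \<open>f\<close> has countably many coordinates.
\<close>
lemma constant_into_cw_complex:
  assumes S: "S \<subseteq> T" and comp: "omega1_compact (subtopology \<tau> S)" and un: "uncountable S"
    and X: "cw_complex X" and f: "continuous_map (subtopology \<tau> S) X f"
  obtains C where "closedin (subtopology \<tau> S) C" "uncountable C"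
    "\<And>s s'. s \<in> C \<Longrightarrow> s' \<in> C \<Longrightarrow> f s = f s'"
proof -
  obtain E d \<Phi> where "cw_structure X E d \<Phi>" using X by (auto simp: cw_complex_def)
  then interpret cw_decomposition X E d \<Phi> by unfold_locales
  have top: "topspace (subtopology \<tau> S) = S" using S by (auto simp: topspace_subtopology)
  obtain C h where C: "closedin (subtopology \<tau> S) C" "uncountable C"
    and h: "\<And>i :: nat. continuous_map (subtopology (subtopology \<tau> S) C) euclideanreal (h i)"
    and hf: "\<And>s s'. s \<in> C \<Longrightarrow> s' \<in> C \<Longrightarrow> (\<And>i. h i s = h i s') \<Longrightarrow> f s = f s'"
    by (rule euclidean_piece[OF comp t1_sub f]) (use un top in auto)
  have CS: "C \<subseteq> S" using closedin_subset[OF C(1)] top by simp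
  then have eq: "subtopology (subtopology \<tau> S) C = subtopology \<tau> C"
    by (simp add: subtopology_subtopology Int_absorb1)
  have CT: "C \<subseteq> T" and compC: "omega1_compact (subtopology \<tau> C)"
    using CS S omega1_compact_closed_subset[OF comp C(1)] by auto
  obtain x0 where x0: "x0 \<in> trunk C" using uncountable_trunk_nonempty[OF CT compC C(2)] by blast
  obtain x where x: "x \<in> trunk C"
    and hx: "\<And>i s s'. s \<in> C \<inter> above r x \<Longrightarrow> s' \<in> C \<inter> above r x \<Longrightarrow> h i s = h i s'"
    by (rule real_functions_constant[where f = h, OF CT compC x0 h[unfolded eq]]) blast
  show ?thesis
  proof (rule that)
    show "closedin (subtopology \<tau> S) (C \<inter> above r x)"
      using closedin_Int_above[of C x] C(1) eq closedin_trans_full by metis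
    show "uncountable (C \<inter> above r x)" using x by (simp add: trunk_def)
    show "f s = f s'" if "s \<in> C \<inter> above r x" "s' \<in> C \<inter> above r x" for s s'
      using hf hx that by blast
  qed
qed

end

section \<open>Homotopies into manifolds\<close>

text \<open>
  Used with \<open>A = UNIV\<close> to pass to the limit at an end of an interval, and with \<open>A = \<rat>\<close> to reduce an interval of
  times to countably many.
\<close>
lemma closed_agreement:
  assumes M: "Hausdorff_space M"
    and f: "continuous_map (top_of_set {0..1::real}) M f"
    and g: "continuous_map (top_of_set {0..1::real}) M g"
    and ab: "a < b" "{a..b} \<subseteq> {0..1}"
    and eq: "\<And>t. t \<in> A \<Longrightarrow> a < t \<Longrightarrow> t < b \<Longrightarrow> f t = g t"
    and dense: "closure A = UNIV" and t: "t \<in> {a..b}"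
  shows "f t = g t"
proof -
  have "closedin (top_of_set {0..1}) {t \<in> topspace (top_of_set {0..1}). f t = g t}"
    using closedin_continuous_maps_eq[OF M f g] .
  then have "closed {t \<in> {0..1}. f t = g t}"
    using closedin_closed_trans[of "{0..1::real}"] by simp
  moreover have "{a<..<b} \<inter> A \<subseteq> {t \<in> {0..1}. f t = g t}" using ab eq by auto
  ultimately have "closure ({a<..<b} \<inter> A) \<subseteq> {t \<in> {0..1}. f t = g t}"
    by (rule closure_minimal[rotated])
  moreover have "closure ({a<..<b} \<inter> A) = {a..b}"
    using closure_open_Int_superset[of "{a<..<b}" A] dense ab by simp
  ultimately show ?thesis using t by auto
qed

context short_tree begin

text \<open>
  At time \<open>t0\<close> the cone is mapped to a single point \<open>p\<close>. The points that leave a chart \<open>W\<close> around \<open>p\<close>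
  within time \<open>1/(k+1)\<close> of \<open>t0\<close> form a closed set, because the projection along the compact
  interval is closed, and each point is outside of this set for large \<open>k\<close>. So for one \<open>k\<close> a whole cone stays in the
  chart. There the coordinates at all rational times are countably many real functions.
\<close>
lemma homotopy_stays_constant_locally:
  assumes S: "S \<subseteq> T" and comp: "omega1_compact (subtopology \<tau> S)"
    and M: "manifold_space M"
    and H: "continuous_map (prod_topology (top_of_set {0..1::real}) (subtopology \<tau> S)) M H"
    and x: "x \<in> S" "x \<in> trunk S" and t0: "0 \<le> t0" "t0 < 1"
    and const: "\<And>s s'. s \<in> S \<inter> above r x \<Longrightarrow> s' \<in> S \<inter> above r x \<Longrightarrow> H (t0, s) = H (t0, s')"
  obtains y b where "y \<in> trunk S" "(x, y) \<in> r" "t0 < b" "b \<le> 1"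
    "\<And>t s s'. t0 \<le> t \<Longrightarrow> t \<le> b \<Longrightarrow> s \<in> S \<inter> above r y \<Longrightarrow> s' \<in> S \<inter> above r y \<Longrightarrow> H (t, s) = H (t, s')"
proof -
  let ?I = "top_of_set {0..1::real}"
  have top: "topspace (subtopology \<tau> S) = S" using S by (auto simp: topspace_subtopology)
  have haus: "Hausdorff_space M" using M by (simp add: manifold_space_def)
  have HM: "H (t, s) \<in> topspace M" if "t \<in> {0..1}" "s \<in> S" for t s
    using continuous_map_image_subset_topspace[OF H] that top by auto
  have path: "continuous_map ?I M (\<lambda>t. H (t, s))" if "s \<in> S" for s
  proof -
    have "continuous_map ?I (prod_topology ?I (subtopology \<tau> S)) (\<lambda>t. (t, s))"
      using that top by (simp add: continuous_map_pairwise o_def)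
    from continuous_map_compose[OF this H] show ?thesis by (simp add: o_def)
  qed
  have slice: "continuous_map (subtopology \<tau> S) M (\<lambda>s. H (t, s))" if "t \<in> {0..1}" for t
  proof -
    have "continuous_map (subtopology \<tau> S) (prod_topology ?I (subtopology \<tau> S)) (\<lambda>s. (t, s))"
      using that by (simp add: continuous_map_pairwise o_def)
    from continuous_map_compose[OF this H] show ?thesis by (simp add: o_def)
  qed
  have xS: "x \<in> S \<inter> above r x" using x S le_refl by (auto simp: above_def)
  define p where "p = H (t0, x)"
  have p: "p \<in> topspace M" using HM x t0 by (simp add: p_def)
  obtain n U where U: "U \<subseteq> topspace M" "p \<in> M interior_of U"
    and chart: "subtopology M U homeomorphic_space Euclidean_space n"
    using M p unfolding manifold_space_def by blast
  obtain \<psi> where \<psi>: "homeomorphic_map (subtopology M U) (Euclidean_space n) \<psi>"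
    using chart by (auto simp: homeomorphic_space)
  define W where "W = M interior_of U"
  have W: "openin M W" "W \<subseteq> U" "p \<in> W" using U by (auto simp: W_def interior_of_subset)
  define J where "J k = {t \<in> {0..1}. \<bar>t - t0\<bar> \<le> inverse (real (Suc k))}" for k
  define C where "C k = {s \<in> S \<inter> above r x. \<exists>t\<in>J k. H (t, s) \<notin> W}" for k
  have "closedin (subtopology \<tau> S) (C k)" for k
  proof -
    let ?P = "prod_topology ?I (subtopology \<tau> S)"
    have "closedin ?P {z \<in> topspace ?P. H z \<in> topspace M - W}"
      by (rule closedin_continuous_map_preimage[OF H]) (simp add: W closedin_diff)
    moreover have "closedin ?P (J k \<times> (S \<inter> above r x))"
    proof -
      have "closed {t :: real. \<bar>t - t0\<bar> \<le> inverse (real (Suc k))}"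
        by (intro closed_Collect_le continuous_intros)
      then have "closedin ?I (J k)"
        using closedin_closed_Int[of "{t. \<bar>t - t0\<bar> \<le> inverse (real (Suc k))}" "{0..1}"]
        by (simp add: J_def Int_def)
      then show ?thesis using closedin_Int_above by (simp add: closedin_prod_Times_iff)
    qed
    ultimately have "closedin ?P ({z \<in> topspace ?P. H z \<in> topspace M - W} \<inter> J k \<times> (S \<inter> above r x))"
      by (rule closedin_Int)
    moreover have "closed_map ?P (subtopology \<tau> S) snd"
      by (rule closed_map_snd) (simp add: compact_space_subtopology)
    ultimately have "closedin (subtopology \<tau> S)
        (snd ` ({z \<in> topspace ?P. H z \<in> topspace M - W} \<inter> J k \<times> (S \<inter> above r x)))"
      by (simp add: closed_map_def)
    moreover have "snd ` ({z \<in> topspace ?P. H z \<in> topspace M - W} \<inter> J k \<times> (S \<inter> above r x)) = C k"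
    proof (intro antisym subsetI)
      fix s assume "s \<in> C k"
      then obtain t where s: "s \<in> S \<inter> above r x" and t: "t \<in> J k" "H (t, s) \<notin> W"
        unfolding C_def by blast
      have "t \<in> {0..1}" using t(1) unfolding J_def by blast
      then have "(t, s) \<in> {z \<in> topspace ?P. H z \<in> topspace M - W} \<inter> J k \<times> (S \<inter> above r x)"
        using s t HM[of t s] top by (simp add: topspace_prod_topology)
      then show "s \<in> snd ` ({z \<in> topspace ?P. H z \<in> topspace M - W} \<inter> J k \<times> (S \<inter> above r x))"
        by (rule rev_image_eqI) simp
    qed (auto simp: C_def)
    ultimately show ?thesis by simp
  qed
  moreover have "(\<Inter>k. C k) = {}"
  proof (rule ccontr)
    assume "(\<Inter>k. C k) \<noteq> {}"
    then obtain s where s: "s \<in> C k" for k by (meson INT_iff UNIV_I ex_in_conv)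
    have sS: "s \<in> S \<inter> above r x" using s[of 0] unfolding C_def by blast
    have "openin ?I {t \<in> topspace ?I. H (t, s) \<in> W}"
      by (rule openin_continuous_map_preimage[OF path W(1)]) (use sS in simp)
    moreover have "t0 \<in> {t \<in> topspace ?I. H (t, s) \<in> W}"
      using const[OF sS xS] W(3) t0 by (simp add: p_def)
    ultimately obtain e where e: "e > 0"
        "\<forall>t\<in>{0..1}. dist t t0 < e \<longrightarrow> t \<in> {t \<in> topspace ?I. H (t, s) \<in> W}"
      unfolding openin_euclidean_subtopology_iff by meson
    obtain k where k: "inverse (real (Suc k)) < e" using reals_Archimedean[OF e(1)] by blast
    then have "H (t, s) \<in> W" if "t \<in> J k" for t
      using that e(2)[rule_format, of t] by (simp add: J_def dist_real_def)
    then show False using s[of k] unfolding C_def by blast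
  qed
  ultimately obtain y k where y: "y \<in> S" "y \<in> trunk S" "(x, y) \<in> r" "C k \<inter> above r y = {}"
    by (rule avoid_closed_set[where C = C, OF S comp x(2)]) blast+
  have in_W: "H (t, s) \<in> W" if "t \<in> J k" "s \<in> S \<inter> above r y" for t s
  proof -
    have "s \<in> above r x" using that y(3) le_trans by (auto simp: above_def)
    then show ?thesis using that y(4) by (auto simp: C_def)
  qed
  let ?S = "S \<inter> above r y"
  have S': "?S \<subseteq> T" using S by auto
  have comp': "omega1_compact (subtopology \<tau> ?S)"
    by (rule omega1_compact_closed_subset[OF comp closedin_Int_above])
  have y': "y \<in> trunk ?S" using y(2) by (simp add: trunk_def Int_assoc)
  define f where "f = (\<lambda>(q :: rat, i) s. if real_of_rat q \<in> J k then \<psi> (H (real_of_rat q, s)) i else 0)"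
  have f: "continuous_map (subtopology \<tau> ?S) euclideanreal (f j)" for j
  proof -
    obtain q i where j: "j = (q, i)" by (cases j)
    show ?thesis
    proof (cases "real_of_rat q \<in> J k")
      case True
      have "continuous_map (subtopology (subtopology \<tau> S) ?S) M (\<lambda>s. H (real_of_rat q, s))"
        by (rule continuous_map_from_subtopology[OF slice]) (use True in \<open>simp add: J_def\<close>)
      then have "continuous_map (subtopology \<tau> ?S) M (\<lambda>s. H (real_of_rat q, s))"
        by (simp add: subtopology_subtopology)
      then have "continuous_map (subtopology \<tau> ?S) (subtopology M U) (\<lambda>s. H (real_of_rat q, s))"
        using in_W[OF True] W(2) by (auto simp: continuous_map_in_subtopology)
      moreover have "continuous_map (subtopology M U) (subtopology (Euclidean_space n) UNIV) \<psi>"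
        using homeomorphic_imp_continuous_map[OF \<psi>] by simp
      ultimately have "continuous_map (subtopology \<tau> ?S) (subtopology (Euclidean_space n) UNIV)
          (\<psi> \<circ> (\<lambda>s. H (real_of_rat q, s)))"
        by (rule continuous_map_compose)
      from Euclidean_space_coordinate[OF this, of i] show ?thesis
        using True by (simp add: f_def j)
    qed (simp add: f_def j)
  qed
  obtain z where z: "z \<in> ?S" "z \<in> trunk ?S" "(y, z) \<in> r"
    and fz: "\<And>j s s'. s \<in> ?S \<inter> above r z \<Longrightarrow> s' \<in> ?S \<inter> above r z \<Longrightarrow> f j s = f j s'"
    by (rule real_functions_constant[where f = f, OF S' comp' y' f]) blast
  have above_z: "s \<in> ?S \<inter> above r z" if "s \<in> S \<inter> above r z" for s
    using that z(3) le_trans by (auto simp: above_def)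
  have rational: "H (q, s) = H (q, s')"
    if q: "q \<in> \<rat>" "q \<in> J k" and s: "s \<in> S \<inter> above r z" "s' \<in> S \<inter> above r z" for q s s'
  proof -
    obtain q' where q': "q = real_of_rat q'" using q(1) by (auto simp: Rats_def)
    have "\<psi> (H (q, s)) i = \<psi> (H (q, s')) i" for i
      using fz[OF above_z[OF s(1)] above_z[OF s(2)], of "(q', i)"] q q' by (simp add: f_def)
    then have "\<psi> (H (q, s)) = \<psi> (H (q, s'))" by (simp add: fun_eq_iff)
    moreover have "H (q, s) \<in> U" "H (q, s') \<in> U"
      using in_W q(2) above_z s W(2) by blast+
    ultimately show ?thesis
      using homeomorphic_imp_injective_map[OF \<psi>] U(1)
      by (auto simp: inj_on_def topspace_subtopology)
  qed
  define b where "b = min 1 (t0 + inverse (real (Suc k)))"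
  have b: "t0 < b" "b \<le> 1" using t0 by (auto simp: b_def)
  show ?thesis
  proof (rule that)
    show "z \<in> trunk S"
      using z(2) countable_subset[of "?S \<inter> above r z" "S \<inter> above r z"] by (auto simp: trunk_def)
    show "(x, z) \<in> r" using y(3) z(3) le_trans by blast
    show "t0 < b" "b \<le> 1" by fact+
    fix t s s' assume t: "t0 \<le> t" "t \<le> b" and s: "s \<in> S \<inter> above r z" "s' \<in> S \<inter> above r z"
    show "H (t, s) = H (t, s')"
    proof (rule closed_agreement[OF haus path path b(1) _ _ Rats_closure_real])
      show "{t0..b} \<subseteq> {0..1}" using t0 b by auto
      show "H (q, s) = H (q, s')" if "q \<in> \<rat>" "t0 < q" "q < b" for q
        using that t0 by (intro rational s) (auto simp: J_def b_def)
    qed (use s t in auto)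
  qed
qed

text \<open>
  Choose \<open>x\<close> that decides, for every rational \<open>q\<close>, whether the homotopy is constant up to time \<open>q\<close> on some smaller cone.
  This makes a supremum of times available: let \<open>t0\<close> be the last time up to which the homotopy is constant
  on the cone over \<open>x\<close>. If \<open>t0 < 1\<close>, then on a smaller cone it is constant up to some
  rational \<open>q > t0\<close>, so by the choice of \<open>x\<close> it already is on the cone over \<open>x\<close>.
\<close>
lemma homotopy_stays_constant:
  assumes S: "S \<subseteq> T" and comp: "omega1_compact (subtopology \<tau> S)" and un: "uncountable S"
    and M: "manifold_space M"
    and H: "continuous_map (prod_topology (top_of_set {0..1::real}) (subtopology \<tau> S)) M H"
    and H0: "\<And>s s'. s \<in> S \<Longrightarrow> s' \<in> S \<Longrightarrow> H (0, s) = H (0, s')"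
  obtains x where "x \<in> trunk S"
    "\<And>s s'. s \<in> S \<inter> above r x \<Longrightarrow> s' \<in> S \<inter> above r x \<Longrightarrow> H (1, s) = H (1, s')"
proof -
  let ?I = "top_of_set {0..1::real}"
  have top: "topspace (subtopology \<tau> S) = S" using S by (auto simp: topspace_subtopology)
  have haus: "Hausdorff_space M" using M by (simp add: manifold_space_def)
  have path: "continuous_map ?I M (\<lambda>t. H (t, s))" if "s \<in> S" for s
  proof -
    have "continuous_map ?I (prod_topology ?I (subtopology \<tau> S)) (\<lambda>t. (t, s))"
      using that top by (simp add: continuous_map_pairwise o_def)
    from continuous_map_compose[OF this H] show ?thesis by (simp add: o_def)
  qed
  have ccc: "ccc S" by (rule omega1_compact_ccc[OF S comp])
  define const where "const x t \<longleftrightarrow> (\<forall>s\<in>S \<inter> above r x. \<forall>s'\<in>S \<inter> above r x. H (t, s) = H (t, s'))" for x t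
  have const_up: "const y t" if "const x t" "(x, y) \<in> r" for x y t
  proof -
    have "above r y \<subseteq> above r x" using that(2) le_trans by (auto simp: above_def)
    then show ?thesis using that(1) unfolding const_def by blast
  qed
  define V where "V q = {x. \<forall>t. 0 \<le> t \<and> t \<le> of_rat q \<longrightarrow> const x t}" for q :: rat
  have V_up: "y \<in> V q" if "x \<in> V q" "(x, y) \<in> r" for q x y
    using that const_up by (auto simp: V_def)
  obtain x0 where x0: "x0 \<in> trunk S" using uncountable_trunk_nonempty[OF S comp un] by blast
  obtain x where x: "x \<in> S" "x \<in> trunk S"
    and dec: "\<And>q y. y \<in> V q \<Longrightarrow> y \<in> trunk S \<Longrightarrow> (x, y) \<in> r \<Longrightarrow> x \<in> V q"
    by (rule decide_up_closed_sets[where U = V, OF ccc x0]) (use V_up in blast)+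
  define G where "G = {t \<in> {0..1}. \<forall>u. 0 \<le> u \<and> u \<le> t \<longrightarrow> const x u}"
  have G0: "0 \<in> G" 
  proof -
    have "const x 0" unfolding const_def using H0 by blast
    then have "const x u" if "0 \<le> u" "u \<le> 0" for u using that by (metis order_antisym)
    then show ?thesis unfolding G_def by auto
  qed
  have G_le: "t \<le> 1" if "t \<in> G" for t using that by (simp add: G_def)
  have G_const: "const x u" if "t \<in> G" "0 \<le> u" "u \<le> t" for t u using that unfolding G_def by blast
  have bdd: "bdd_above G" by (rule bdd_aboveI[of _ 1]) (rule G_le)
  define t0 where "t0 = Sup G"
  have t0: "0 \<le> t0" "t0 \<le> 1"
    unfolding t0_def using cSup_upper[OF G0 bdd] cSup_least[of G 1] G0 G_le by blast+
  have below: "const x u" if u: "0 \<le> u" "u < t0" for u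
  proof -
    obtain t where "t \<in> G" "u < t"
      using less_cSupD[of G u] u G0 unfolding t0_def by blast
    then show ?thesis using u G_const[of t u] by simp
  qed
  have at: "const x t0"
  proof (cases "t0 = 0")
    case True
    then show ?thesis using G_const[OF G0, of 0] by simp
  next
    case False
    show ?thesis unfolding const_def
    proof (intro ballI)
      fix s s' assume s: "s \<in> S \<inter> above r x" "s' \<in> S \<inter> above r x"
      show "H (t0, s) = H (t0, s')"
      proof (rule closed_agreement[OF haus path path, of _ _ 0 t0 UNIV])
        show "H (t, s) = H (t, s')" if "0 < t" "t < t0" for t
        proof -
          have "const x t" using that by (intro below) simp_all
          then show ?thesis using s unfolding const_def by blast
        qed
      qed (use s t0 False in auto)
    qed
  qed
  have "t0 = 1"
  proof (rule ccontr)
    assume "t0 \<noteq> 1"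
    then have "t0 < 1" using t0 by simp
    then obtain y b where y: "y \<in> trunk S" "(x, y) \<in> r" and b: "t0 < b" "b \<le> 1"
      and yb: "\<And>t s s'. t0 \<le> t \<Longrightarrow> t \<le> b \<Longrightarrow> s \<in> S \<inter> above r y \<Longrightarrow> s' \<in> S \<inter> above r y \<Longrightarrow> H (t, s) = H (t, s')"
      by (rule homotopy_stays_constant_locally[OF S comp M H x t0(1) _ at[unfolded const_def, rule_format]])
        blast+
    obtain q where q: "t0 < of_rat q" "of_rat q < b" using of_rat_dense[OF b(1)] by blast
    have "const y t" if "0 \<le> t" "t \<le> of_rat q" for t
    proof (cases "t < t0")
      case True
      then show ?thesis using below that const_up y(2) by blast
    next
      case False
      then have "t0 \<le> t" "t \<le> b" using that q by simp_all
      then show ?thesis using yb[of t] unfolding const_def by blast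
    qed
    then have "y \<in> V q" by (simp add: V_def)
    then have "x \<in> V q" using dec y by blast
    then have "const x u" if "0 \<le> u" "u \<le> of_rat q" for u
      using that unfolding V_def by blast
    moreover have "0 \<le> real_of_rat q" "real_of_rat q \<le> 1" using q b t0 by linarith+
    ultimately have "real_of_rat q \<in> G" unfolding G_def by (simp del: zero_le_of_rat_iff of_rat_le_1_iff)
    then have "real_of_rat q \<le> t0" unfolding t0_def using bdd by (rule cSup_upper)
    then show False using q by simp
  qed
  with at have "const x 1" by simp
  then show ?thesis using that[OF x(2)] unfolding const_def by blast
qed

text \<open>
  Along a homotopy from \<open>g \<circ> f\<close> to the identity of \<open>M\<close>, the map \<open>g \<circ> f \<circ> k\<close>, which is constant on an
  uncountable closed subset, is deformed into the injective map \<open>k\<close>.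
\<close>
lemma not_homotopy_equivalent_cw_complex:
  assumes S: "S \<subseteq> T" and comp: "omega1_compact (subtopology \<tau> S)" and un: "uncountable S"
    and M: "manifold_space M" and copy: "contains_copy M (subtopology \<tau> S)"
    and X: "cw_complex X"
  shows "\<not> M homotopy_equivalent_space X"
proof
  assume "M homotopy_equivalent_space X"
  then obtain f g where f: "continuous_map M X f" and g: "continuous_map X M g"
    and hom: "homotopic_with (\<lambda>x. True) M M (g \<circ> f) id"
    by (auto simp: homotopy_equivalent_space_def)
  obtain h where h: "continuous_map (prod_topology (top_of_set {0..1::real}) M) M h"
    and h0: "\<And>x. h (0, x) = g (f x)" and h1: "\<And>x. h (1, x) = x"
    using hom by (auto simp: homotopic_with_def)
  obtain N where "subtopology \<tau> S homeomorphic_space subtopology M N"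
    using copy homeomorphic_space_sym by (auto simp: contains_copy_def)
  then obtain k where hk: "homeomorphic_map (subtopology \<tau> S) (subtopology M N) k"
    by (auto simp: homeomorphic_space)
  have k: "continuous_map (subtopology \<tau> S) M k"
    using homeomorphic_imp_continuous_map[OF hk] by (rule continuous_map_into_fulltopology)
  have inj: "inj_on k S"
    using homeomorphic_imp_injective_map[OF hk] S by (simp add: Int_absorb1)
  obtain C where C: "closedin (subtopology \<tau> S) C" "uncountable C"
    and fk: "\<And>s s'. s \<in> C \<Longrightarrow> s' \<in> C \<Longrightarrow> (f \<circ> k) s = (f \<circ> k) s'"
    by (rule constant_into_cw_complex[OF S comp un X continuous_map_compose[OF k f]]) blast
  have CS: "C \<subseteq> S" using closedin_subset[OF C(1)] by (simp add: topspace_subtopology)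
  have CT: "C \<subseteq> T" and compC: "omega1_compact (subtopology \<tau> C)"
    using CS S omega1_compact_closed_subset[OF comp C(1)] by auto
  have kC: "continuous_map (subtopology \<tau> C) M k"
    using continuous_map_from_subtopology_mono[OF k CS] .
  let ?P = "prod_topology (top_of_set {0..1::real}) (subtopology \<tau> C)"
  have "continuous_map ?P (prod_topology (top_of_set {0..1}) M) (\<lambda>z. (fst z, k (snd z)))"
    using continuous_map_compose[OF continuous_map_snd kC]
    by (simp add: continuous_map_pairwise o_def continuous_map_fst)
  note track = continuous_map_compose[OF this h]
  define H where "H = (\<lambda>z. h (fst z, k (snd z)))"
  have H: "continuous_map ?P M H" using track by (simp add: o_def H_def)
  have H0: "H (0, s) = H (0, s')" if "s \<in> C" "s' \<in> C" for s s'
    using fk[OF that] by (simp add: H_def h0)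
  show False
  proof (rule homotopy_stays_constant[OF CT compC C(2) M H H0])
    fix x assume x: "x \<in> trunk C"
      and const: "\<And>s s'. s \<in> C \<inter> above r x \<Longrightarrow> s' \<in> C \<inter> above r x \<Longrightarrow> H (1, s) = H (1, s')"
    have unx: "uncountable (C \<inter> above r x)" using x by (simp add: trunk_def)
    then have "C \<inter> above r x \<noteq> {}" by (metis countable_empty)
    then obtain s where s: "s \<in> C \<inter> above r x" by blast
    have "C \<inter> above r x \<subseteq> {s}"
    proof
      fix s' assume s': "s' \<in> C \<inter> above r x"
      then have "k s' = k s" using const[OF s' s] by (simp add: H_def h1)
      then show "s' \<in> {s}" using inj s s' CS by (auto simp: inj_on_def)
    qed
    then have "countable (C \<inter> above r x)" by (rule countable_subset) simp
    then show False using unx by simp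
  qed
qed

end

theorem theorem1p4:
  fixes T :: "'t set" and r :: "'t rel" and S :: "'t set"
    and T' :: "'u set" and r' :: "'u rel"
    and M :: "'m topology"
  assumes "manifold_space M"
  shows "(omega1_tree T r \<and> S \<subseteq> T \<and> uncountable S \<and>
            omega1_compact (subtopology (tree_topology T r) S) \<and>
            contains_copy M (subtopology (tree_topology T r) S) \<longrightarrow>
          \<not> (\<exists>X :: 'x topology. cw_complex X \<and> M homotopy_equivalent_space X)) \<and>
         (suslin_tree T' r' \<and> contains_copy M (tree_topology T' r') \<longrightarrow>
          \<not> (\<exists>X :: 'x topology. cw_complex X \<and> M homotopy_equivalent_space X))"
proof (intro conjI impI)
  assume A: "omega1_tree T r \<and> S \<subseteq> T \<and> uncountable S \<and>
            omega1_compact (subtopology (tree_topology T r) S) \<and>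
            contains_copy M (subtopology (tree_topology T r) S)"
  then interpret short_tree T r
    by (intro omega1_height_short_tree) (auto simp: omega1_tree_def)
  show "\<not> (\<exists>X :: 'x topology. cw_complex X \<and> M homotopy_equivalent_space X)"
    using not_homotopy_equivalent_cw_complex[of S M] A assms by blast
next
  assume A: "suslin_tree T' r' \<and> contains_copy M (tree_topology T' r')"
  then have ht: "has_tree_height T' r' omega1" by (simp add: suslin_tree_def)
  then interpret short_tree T' r'
    using A by (intro omega1_height_short_tree) (auto simp: suslin_tree_def)
  have "ccc T'" using A by (auto simp: ccc_def suslin_tree_def)
  then have "omega1_compact (tree_topology T' r')" by (rule ccc_imp_omega1_compact)
  moreover have "subtopology (tree_topology T' r') T' = tree_topology T' r'"
    using subtopology_topspace[of "tree_topology T' r'"] by simp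
  ultimately show "\<not> (\<exists>X :: 'x topology. cw_complex X \<and> M homotopy_equivalent_space X)"
    using not_homotopy_equivalent_cw_complex[of T' M] omega1_height_uncountable[OF ht] A assms
    by auto
qed

end
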